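(* Let $n\geq 3$ and $m\geq 3$ be integers. Then $\Delta_m^{n,2}=\mathrm{VR}(\{0,1,\ldots,m\}^n;2)$ is homotopy equivalent to a wedge sum $\bigvee^{\nu_m}\mathbb{S}^3$ of $\nu_m$ copies of the $3$-sphere, where $\nu_m\geq (m-2)^3$.
   Context: $\{0,1,\ldots,m\}^n\subseteq\mathbb{Z}^n$ carries the Manhattan metric $d(x,y)=\sum_{i=1}^n |x_i-y_i|$. For a metric space $X$ and $r\geq 0$, $\mathrm{VR}(X;r)$ is the simplicial complex with vertex set $X$ whose simplices are the finite subsets of $X$ of diameter at most $r$. *)

theory Defs
  imports "HOL-Analysis.Analysis"
begin

definition grid :: "nat \<Rightarrow> nat \<Rightarrow> (nat \<Rightarrow> int) set" where
  "grid n m = PiE {..<n} (\<lambda>_. {0..int m})"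

definition manhattan :: "nat \<Rightarrow> (nat \<Rightarrow> int) \<Rightarrow> (nat \<Rightarrow> int) \<Rightarrow> int" where
  "manhattan n x y = (\<Sum>i<n. \<bar>x i - y i\<bar>)"

definition VR :: "'a set \<Rightarrow> ('a \<Rightarrow> 'a \<Rightarrow> 'b::linorder) \<Rightarrow> 'b \<Rightarrow> 'a set set" where
  "VR X d r = {\<sigma>. \<sigma> \<subseteq> X \<and> finite \<sigma> \<and> \<sigma> \<noteq> {} \<and> (\<forall>x\<in>\<sigma>. \<forall>y\<in>\<sigma>. d x y \<le> r)}"

text \<open>Standard geometric realization of a simplicial complex K on a finite vertex set V,
  as a subspace of R^V: barycentric coordinate functions whose support is a simplex.\<close>
definition geom_realization :: "'a set \<Rightarrow> 'a set set \<Rightarrow> ('a \<Rightarrow> real) topology" where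
  "geom_realization V K = subtopology (powertop_real V)
     {f \<in> V \<rightarrow>\<^sub>E (UNIV::real set). (\<forall>v\<in>V. 0 \<le> f v) \<and> sum f V = 1 \<and> {v\<in>V. f v \<noteq> 0} \<in> K}"

text \<open>Wedge of k copies of S^3, realized in R^4 as the union of the 3-spheres of radius i
  centred at i*e_1 (i = 1..k), which pairwise meet exactly in the origin (the base point).\<close>
definition wedge_S3 :: "nat \<Rightarrow> (real^4) topology" where
  "wedge_S3 k = top_of_set ({0} \<union> (\<Union>i\<in>{1..k}. sphere (real i *\<^sub>R axis 1 1) (real i)))"

end

(*
  Order the grid by levels, the level of a point being given by the position and the value of its
  last nonzero coordinate. If v and w are at
  distance at most 2 from x and have smaller level, then the last nonzero coordinate of x exceeds the
  corresponding coordinates of v and w, and d(v,w) <= 2 follows. Hence for every simplex s that lies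
  in one positive level, the vertices below s that are adjacent to all of s span a simplex, and if
  there is one the star of s can be collapsed away. Doing this by decreasing level and dimension
  collapses everything to the origin, except for the critical simplices, which have no common lower
  neighbour. By a median argument a clique of the grid with other than 4 vertices has a center within
  distance 1 of all of its vertices, and a center moved one step down is a common lower neighbour; so
  the critical simplices are 3-dimensional facets. The complex is thus a contractible complex with
  3-cells attached, i.e. a wedge of 3-spheres, one for each critical simplex. The unit squares in
  the first two coordinates at positive height in the third already give m^3 critical simplices.
*)

theory Submission
  imports Defs
begin

section \<open>Geometric realizations and collapses\<close>

text \<open>The passage from a contractible part with 3-cells to a wedge is carried out with an
  explicit map onto the nested spheres in R^4, sending the noncritical part to the origin and each
  open critical cell bijectively onto its sphere without the origin. Since this map goes from a
  compact space onto a Hausdorff space, it is a quotient map, and maps and homotopies of the complex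
  descend along it once the contraction of the noncritical part has been extended over the cells.
  The collapses must be ordered so that coning with a lower vertex w never re-creates a removed
  simplex. Removed stars belong to horizontal simplices of at least the current rank, and a
  horizontal simplex through w lies in a lower level, so it is not among them. Four is the
  exceptional size for centers: the corners of a unit square have none, nor have the four even
  vertices of a unit 3-cube.\<close>

lemma topspace_geom_realization:
  "topspace (geom_realization V K) =
    {f \<in> V \<rightarrow>\<^sub>E UNIV. (\<forall>v\<in>V. 0 \<le> f v) \<and> sum f V = 1 \<and> {v\<in>V. f v \<noteq> 0} \<in> K}"
  by (auto simp: geom_realization_def PiE_UNIV_domain)

lemma continuous_map_geom_realization:
  "continuous_map X (geom_realization V K) g \<longleftrightarrow>
    g \<in> topspace X \<rightarrow> topspace (geom_realization V K) \<and>
    (\<forall>v\<in>V. continuous_map X euclideanreal (\<lambda>x. g x v))"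
  unfolding topspace_geom_realization
  by (auto simp: geom_realization_def continuous_map_in_subtopology continuous_map_componentwise PiE_iff)

lemma continuous_map_geom_realization_coordinate [continuous_intros]:
  assumes "v \<in> V"
  shows "continuous_map (geom_realization V K) euclideanreal (\<lambda>f. f v)"
  using assms unfolding geom_realization_def
  by (intro continuous_intros)

text \<open>Serves the smallest barycentric coordinate over a simplex, which governs both the
  removal of a star and the map to the spheres.\<close>

lemma continuous_map_real_Min:
  assumes "finite S" "S \<noteq> {}" "\<And>v. v \<in> S \<Longrightarrow> continuous_map X euclideanreal (\<lambda>x. g x v)"
  shows "continuous_map X euclideanreal (\<lambda>x. Min (g x ` S) :: real)"
  using assms
proof (induction S rule: finite_ne_induct)
  case (insert a S)
  have "(\<lambda>x. Min (g x ` insert a S)) = (\<lambda>x. min (g x a) (Min (g x ` S)))"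
    using insert.hyps by simp
  then show ?case
    using insert by (simp add: continuous_map_real_min)
qed simp

section \<open>Finite complexes and the removal of an open star\<close>

locale finite_complex =
  fixes V :: "'a set" and K :: "'a set set"
  assumes finite_vertices: "finite V"
    and simplex_subset: "\<sigma> \<in> K \<Longrightarrow> \<sigma> \<subseteq> V"
    and simplex_nonempty: "\<sigma> \<in> K \<Longrightarrow> \<sigma> \<noteq> {}"
    and face_closed: "\<sigma> \<in> K \<Longrightarrow> \<tau> \<subseteq> \<sigma> \<Longrightarrow> \<tau> \<noteq> {} \<Longrightarrow> \<tau> \<in> K"
begin

lemma finite_simplices: "finite K"
  using finite_vertices simplex_subset by (meson Pow_iff finite_Pow_iff finite_subset subsetI)

text \<open>It is enough that \<open>\<sigma>\<close> contains the support: coordinates with sum 1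
  have nonempty support, which is then a face of \<open>\<sigma>\<close>.\<close>

lemma realization_intro:
  assumes "f \<in> extensional V" "\<And>v. v \<in> V \<Longrightarrow> 0 \<le> f v" "sum f V = 1"
    "\<sigma> \<in> K" "\<And>v. v \<in> V - \<sigma> \<Longrightarrow> f v = 0"
  shows "f \<in> topspace (geom_realization V K)"
proof -
  have "{v\<in>V. f v \<noteq> 0} \<noteq> {}"
    using assms(3) by (metis (mono_tags, lifting) empty_Collect_eq sum.neutral zero_neq_one)
  moreover have "{v\<in>V. f v \<noteq> 0} \<subseteq> \<sigma>"
    using assms(5) by auto
  ultimately show ?thesis
    using assms face_closed by (auto simp: topspace_geom_realization PiE_iff)
qed

text \<open>If every simplex containing \<open>\<sigma>\<close> can be coned off by \<open>w\<close>, mass is moved at equal speed from the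
  vertices of \<open>\<sigma>\<close> to \<open>w\<close> until one of the barycentric coordinates in \<open>\<sigma>\<close> vanishes.\<close>

lemma collapse_star:
  assumes "w \<in> V" "w \<notin> \<sigma>" "\<sigma> \<noteq> {}" "\<sigma> \<subseteq> V"
    and cone: "\<And>\<tau>. \<tau> \<in> K \<Longrightarrow> \<sigma> \<subseteq> \<tau> \<Longrightarrow> insert w \<tau> \<in> K"
  shows "geom_realization V K homotopy_equivalent_space geom_realization V {\<tau>\<in>K. \<not> \<sigma> \<subseteq> \<tau>}"
proof -
  let ?L = "{\<tau>\<in>K. \<not> \<sigma> \<subseteq> \<tau>}"
  interpret L: finite_complex V ?L
    using finite_vertices simplex_subset simplex_nonempty face_closed
    by unfold_locales blast+
  let ?X = "geom_realization V K" and ?Y = "geom_realization V ?L"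
  have fin: "finite \<sigma>"
    using \<open>\<sigma> \<subseteq> V\<close> finite_vertices finite_subset by blast
  define t where "t f = Min (f ` \<sigma>)" for f :: "'a \<Rightarrow> real"
  \<comment> \<open>The direction of flow: what the \<open>card \<sigma>\<close> vertices lose is
    gained by \<open>w\<close>, so the total mass is kept. The factor \<open>t f\<close> in
    \<open>h\<close> makes points of the subcomplex stand still and lets a coordinate in
    \<open>\<sigma>\<close> reach 0 exactly at time 1.\<close>
  define D where "D v = (if v \<in> \<sigma> then 1 else if v = w then - real (card \<sigma>) else 0)" for v
  define h where "h s f = restrict (\<lambda>v. f v - s * t f * D v) V" for s :: real and f
  have sumD: "sum D V = 0"
  proof -
    have "sum D V = sum D (insert w \<sigma>)"
      using assms finite_vertices by (intro sum.mono_neutral_right) (auto simp: D_def)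
    also have "\<dots> = D w + sum D \<sigma>"
      using fin \<open>w \<notin> \<sigma>\<close> by simp
    also have "sum D \<sigma> = real (card \<sigma>)"
      by (simp add: D_def)
    finally show ?thesis
      using \<open>w \<notin> \<sigma>\<close> by (simp add: D_def)
  qed
  have t_le: "t f \<le> f v" if "v \<in> \<sigma>" for f v
    using that fin by (simp add: t_def)
  have t_in: "\<exists>v\<in>\<sigma>. f v = t f" for f
  proof -
    have "t f \<in> f ` \<sigma>"
      unfolding t_def using fin \<open>\<sigma> \<noteq> {}\<close> by (intro Min_in) auto
    then show ?thesis by auto
  qed
  have t_ge: "0 \<le> t f" if "f \<in> topspace ?X" for f
    using t_in[of f] that \<open>\<sigma> \<subseteq> V\<close> by (fastforce simp: topspace_geom_realization)
  have h_nonneg: "0 \<le> h s f v" if "f \<in> topspace ?X" "s \<in> {0..1}" "v \<in> V" for s f v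
  proof -
    have "s * t f \<le> t f"
      using that t_ge by (simp add: mult_left_le_one_le)
    moreover have "0 \<le> s * t f"
      using that t_ge by simp
    moreover have "0 \<le> f v"
      using that by (simp add: topspace_geom_realization)
    moreover have "0 \<le> s * t f * real (card \<sigma>)"
      using \<open>0 \<le> s * t f\<close> by (rule mult_nonneg_nonneg) simp
    ultimately have "s * t f * D v \<le> f v"
      using t_le[of v f] by (cases "v \<in> \<sigma>"; cases "v = w"; simp add: D_def del: zero_le_mult_iff; linarith)
    then show ?thesis
      using that by (simp add: h_def)
  qed
  have h_sum: "sum (h s f) V = 1" if "f \<in> topspace ?X" for s f
  proof -
    have "sum (h s f) V = sum f V - s * t f * sum D V"
      by (simp add: h_def sum_subtractf sum_distrib_left)
    then show ?thesis
      using that sumD by (simp add: topspace_geom_realization)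
  qed
  \<comment> \<open>If \<open>t f\<close> is positive, the support contains \<open>\<sigma>\<close>
    and may be coned off by \<open>w\<close>; otherwise the point does not move and no room for
    \<open>w\<close> is required.\<close>
  have supp: "\<exists>\<tau>\<in>K. {v\<in>V. f v \<noteq> 0} \<subseteq> \<tau> \<and> (0 < t f \<longrightarrow> w \<in> \<tau>)" if "f \<in> topspace ?X" for f
  proof (cases "0 < t f")
    case True
    have "\<sigma> \<subseteq> {v\<in>V. f v \<noteq> 0}"
      using True t_le[of _ f] \<open>\<sigma> \<subseteq> V\<close> by force
    then have "insert w {v\<in>V. f v \<noteq> 0} \<in> K"
      using that cone by (simp add: topspace_geom_realization)
    then show ?thesis by blast
  next
    case False
    then show ?thesis
      using that by (auto simp: topspace_geom_realization)
  qed
  have h_in_X: "h s f \<in> topspace ?X" if f: "f \<in> topspace ?X" and s: "s \<in> {0..1}" for s f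
  proof -
    obtain \<tau> where \<tau>: "\<tau> \<in> K" "{v\<in>V. f v \<noteq> 0} \<subseteq> \<tau>" "0 < t f \<longrightarrow> w \<in> \<tau>"
      using supp f by blast
    have "h s f v = 0" if "v \<in> V - \<tau>" for v
    proof -
      have "f v = 0" using that \<tau> by blast
      moreover have "v \<in> \<sigma> \<Longrightarrow> t f = 0" using t_le[of v f] t_ge[OF f] \<open>f v = 0\<close> by simp
      moreover have "v = w \<Longrightarrow> t f = 0" using \<tau>(3) that t_ge[OF f] by force
      ultimately show ?thesis using that by (auto simp: h_def D_def)
    qed
    then show ?thesis
      using h_nonneg h_sum f s \<tau>(1) by (intro realization_intro) (auto simp: h_def)
  qed
  have h1: "h 1 f \<in> topspace ?Y" if f: "f \<in> topspace ?X" for f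
  proof -
    obtain v where v: "v \<in> \<sigma>" "f v = t f"
      using t_in by blast
    then have "h 1 f v = 0"
      using \<open>\<sigma> \<subseteq> V\<close> by (auto simp: h_def D_def)
    then have "\<not> \<sigma> \<subseteq> {v\<in>V. h 1 f v \<noteq> 0}"
      using v by auto
    then show ?thesis
      using h_in_X[OF f, of 1] by (auto simp: topspace_geom_realization)
  qed
  have cont: "continuous_map (prod_topology (top_of_set {0..1}) ?X) euclideanreal (\<lambda>x. h (fst x) (snd x) v)"
    if "v \<in> V" for v
  proof -
    have c: "continuous_map (prod_topology (top_of_set {0..1}) ?X) euclideanreal (\<lambda>x. snd x u)" if "u \<in> V" for u
      using continuous_map_compose[OF continuous_map_snd continuous_map_geom_realization_coordinate[OF that]]
      by (simp add: o_def)
    have "continuous_map (prod_topology (top_of_set {0..1}) ?X) euclideanreal (\<lambda>x. t (snd x))"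
      unfolding t_def using fin \<open>\<sigma> \<noteq> {}\<close> \<open>\<sigma> \<subseteq> V\<close> c by (intro continuous_map_real_Min) auto
    moreover have "continuous_map (prod_topology (top_of_set {0..1::real}) ?X) euclideanreal fst"
      by (metis continuous_map_fst continuous_map_into_fulltopology)
    ultimately have "continuous_map (prod_topology (top_of_set {0..1}) ?X) euclideanreal
        (\<lambda>x. snd x v - fst x * t (snd x) * D v)"
      using c[OF that] by (intro continuous_intros)
    then show ?thesis
      using that by (simp add: h_def)
  qed
  have h0: "h 0 f = f" if "f \<in> topspace ?X" for f
    using that by (auto simp: h_def topspace_geom_realization fun_eq_iff PiE_iff extensional_def)
  have hom: "homotopic_with (\<lambda>x. True) ?X ?X id (h 1)"
    unfolding homotopic_with_def
  proof (intro exI conjI)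
    \<comment> \<open>\<open>homotopic_with_def\<close> asks for \<open>id\<close> at time 0 at
      every function, while \<open>h 0\<close> restricts to \<open>V\<close>; hence the case
      distinction.\<close>
    show "continuous_map (prod_topology (top_of_set {0..1}) ?X) ?X
        (\<lambda>x. if fst x = 0 then snd x else h (fst x) (snd x))"
    proof (rule continuous_map_eq)
      show "continuous_map (prod_topology (top_of_set {0..1}) ?X) ?X (\<lambda>x. h (fst x) (snd x))"
        unfolding continuous_map_geom_realization using cont h_in_X by auto
    qed (auto simp: h0)
  qed auto
  have Y_sub: "topspace ?Y \<subseteq> topspace ?X"
    by (auto simp: topspace_geom_realization)
  have "retraction_maps ?X ?Y (h 1) id"
    unfolding retraction_maps_def
  proof (intro conjI ballI)
    have "continuous_map ?X euclideanreal (\<lambda>f. h 1 f v)" if "v \<in> V" for v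
    proof -
      have "continuous_map ?X (prod_topology (top_of_set {0..1}) ?X) (\<lambda>f. (1::real, f))"
        by (simp add: continuous_map_paired)
      from continuous_map_compose[OF this cont[OF that]] show ?thesis
        by (simp add: o_def)
    qed
    then show "continuous_map ?X ?Y (h 1)"
      using h1 by (auto simp: continuous_map_geom_realization)
    show "continuous_map ?Y ?X id"
      using Y_sub continuous_map_geom_realization_coordinate
      by (auto simp: continuous_map_geom_realization)
    fix f assume f: "f \<in> topspace ?Y"
    then have "\<not> \<sigma> \<subseteq> {v\<in>V. f v \<noteq> 0}"
      by (auto simp: topspace_geom_realization)
    then obtain v where "v \<in> \<sigma>" "f v = 0"
      using \<open>\<sigma> \<subseteq> V\<close> by blast
    then have "t f = 0"
      using t_le[of v f] t_ge[of f] f Y_sub by fastforce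
    then show "h 1 (id f) = f"
      using h0[of f] f Y_sub by (auto simp: h_def)
  qed
  moreover have "homotopic_with (\<lambda>x. True) ?X ?X (id \<circ> h 1) id"
    using hom by (simp add: homotopic_with_sym)
  ultimately show ?thesis
    by (rule deformation_retraction_imp_homotopy_equivalent_space[rotated])
qed

end

lemma contractible_realization_vertex:
  assumes "finite V" "v \<in> V"
  shows "contractible_space (geom_realization V {{v}})"
proof -
  let ?f = "restrict (\<lambda>u. if u = v then 1 else 0) V"
  have "f = ?f" if f: "f \<in> topspace (geom_realization V {{v}})" for f
  proof -
    have "{u\<in>V. f u \<noteq> 0} = {v}" and s: "sum f V = 1" and "f \<in> extensional V"
      using f by (auto simp: topspace_geom_realization PiE_iff)
    then have 0: "\<And>u. u \<in> V \<Longrightarrow> u \<noteq> v \<Longrightarrow> f u = 0" by blast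
    have "sum f V = f v"
      using assms 0 by (simp add: sum.remove[of V v])
    then show ?thesis
      using 0 s \<open>f \<in> extensional V\<close> by (auto simp: fun_eq_iff extensional_def)
  qed
  then have "topspace (geom_realization V {{v}}) \<subseteq> {?f}" by blast
  then show ?thesis
    by (rule contractible_space_subset_singleton)
qed

section \<open>Collapsing the boundary of a 3-simplex\<close>

text \<open>\<open>bubble\<close> is the inversion of the vector \<open>bubble_vec a\<close>; it collapses the boundary of the
  standard 3-simplex to the origin and maps its interior bijectively to the rest of the unit sphere
  centred at \<open>axis 1 1\<close>. The square in the denominator vanishes on the simplex; it only serves to
  make the formula continuous everywhere.\<close>

definition height :: "(4 \<Rightarrow> real) \<Rightarrow> real" where
  "height a = 4 * Min (range a)"

definition bubble_vec :: "(4 \<Rightarrow> real) \<Rightarrow> real^4" where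
  "bubble_vec a = (\<chi> k. if k = 1 then height a else a k - a 1)"

definition bubble_denom :: "(4 \<Rightarrow> real) \<Rightarrow> real" where
  "bubble_denom a = bubble_vec a \<bullet> bubble_vec a + (1 - sum a UNIV)\<^sup>2"

definition bubble :: "(4 \<Rightarrow> real) \<Rightarrow> real^4" where
  "bubble a = (2 * height a / bubble_denom a) *\<^sub>R bubble_vec a"

lemma height_le: "height a \<le> 4 * a k"
  by (simp add: height_def)

lemma height_attained: "\<exists>k. height a = 4 * a k"
proof -
  have "Min (range a) \<in> range a"
    by (rule Min_in) auto
  then obtain k where "Min (range a) = a k" by blast
  then show ?thesis
    by (auto simp: height_def)
qed

text \<open>A minimum commutes with nondecreasing affine maps. This turns the height of a point with
  prescribed shape into a linear equation for its scale.\<close>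

lemma height_affine:
  assumes "0 \<le> t"
  shows "height (\<lambda>k. x + t * c k) = 4 * x + t * height c"
proof (rule antisym)
  obtain k where "height c = 4 * c k"
    using height_attained by blast
  then show "height (\<lambda>k. x + t * c k) \<le> 4 * x + t * height c"
    using height_le[of "\<lambda>k. x + t * c k" k] by (simp add: algebra_simps)
  obtain k where "height (\<lambda>k. x + t * c k) = 4 * (x + t * c k)"
    using height_attained[of "\<lambda>k. x + t * c k"] by blast
  moreover have "t * height c \<le> t * (4 * c k)"
    using assms height_le by (rule mult_left_mono[rotated])
  ultimately show "4 * x + t * height c \<le> height (\<lambda>k. x + t * c k)"
    by (simp add: algebra_simps)
qed

text \<open>If both squares vanish, all four coordinates are equal and the height is 0, so every
  coordinate is 0, against the sum being 1.\<close>

lemma bubble_denom_pos: "0 < bubble_denom a"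
proof (rule ccontr)
  assume "\<not> 0 < bubble_denom a"
  moreover have "0 \<le> bubble_vec a \<bullet> bubble_vec a" "0 \<le> (1 - sum a UNIV)\<^sup>2"
    by auto
  ultimately have "bubble_vec a \<bullet> bubble_vec a = 0" "(1 - sum a UNIV)\<^sup>2 = 0"
    unfolding bubble_denom_def by linarith+
  then have z: "bubble_vec a = 0" and s: "sum a UNIV = 1"
    by auto
  have a: "a k = a 1" for k
    using arg_cong[OF z, of "\<lambda>v. v $ k"] by (cases "k = 1") (auto simp: bubble_vec_def)
  have "height a = 0"
    using arg_cong[OF z, of "\<lambda>v. v $ 1"] by (simp add: bubble_vec_def)
  then have "a 1 = 0"
    using height_attained[of a] a by (metis mult_eq_0_iff zero_neq_numeral)
  then have "sum a UNIV = 0"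
    using a by (simp add: sum.neutral)
  then show False
    using s by simp
qed

lemma bubble_eq_0: "height a = 0 \<Longrightarrow> bubble a = 0"
  by (simp add: bubble_def)

lemma bubble_1: "bubble a $ 1 = 2 * (height a)\<^sup>2 / bubble_denom a"
  by (simp add: bubble_def bubble_vec_def power2_eq_square)

lemma bubble_1_pos: "0 < height a \<Longrightarrow> 0 < bubble a $ 1"
  using bubble_denom_pos by (simp add: bubble_1)

text \<open>With sum 1 the denominator is the squared length of \<open>bubble_vec a\<close>, whose
  first entry is the height. The equation y . y = 2 y_1 describes the unit sphere centred at
  \<open>axis 1 1\<close>.\<close>

lemma bubble_inner:
  assumes "sum a UNIV = 1"
  shows "bubble a \<bullet> bubble a = 2 * bubble a $ 1"
proof -
  have "bubble_vec a \<bullet> bubble_vec a = bubble_denom a"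
    using assms by (simp add: bubble_denom_def)
  then show ?thesis
    using bubble_denom_pos[of a]
    unfolding bubble_1 by (simp add: bubble_def power2_eq_square)
qed

text \<open>The shape of \<open>a\<close> up to translation and scaling, as seen from its image under \<open>bubble\<close>.\<close>

definition bubble_shape :: "real^4 \<Rightarrow> 4 \<Rightarrow> real" where
  "bubble_shape y k = (if k = 1 then 0 else y $ k / y $ 1)"

text \<open>The scalar factor of the inversion cancels in quotients of coordinates.\<close>

lemma bubble_shape:
  assumes "0 < height a"
  shows "a k = a 1 + height a * bubble_shape (bubble a) k"
proof (cases "k = 1")
  case False
  then have "bubble a $ k / bubble a $ 1 = (a k - a 1) / height a"
    using assms bubble_denom_pos[of a]
    by (simp add: bubble_def bubble_vec_def)
  then show ?thesis
    using False assms by (simp add: bubble_shape_def)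
qed (simp add: bubble_shape_def)

text \<open>Given the shape, a point has two unknowns, its height and \<open>a 1\<close>. Total mass
  1 and the definition of the height are two linear equations for them with coefficients that depend
  only on the image, whence injectivity.\<close>

lemma bubble_recover:
  assumes "0 < height a" "sum a UNIV = 1"
  defines "c \<equiv> bubble_shape (bubble a)"
  shows "height a * (1 + sum c UNIV - height c) = 1"
    and "4 * a 1 = 1 - height a * sum c UNIV"
proof -
  have a: "a = (\<lambda>k. a 1 + height a * c k)"
    using bubble_shape[OF assms(1)] unfolding c_def by (rule ext)
  have "sum a UNIV = (\<Sum>k\<in>UNIV. a 1 + height a * c k)"
    by (rule arg_cong[OF a])
  then have 1: "1 = 4 * a 1 + height a * sum c UNIV"
    using assms(2) by (simp add: sum.distrib sum_distrib_left)
  then show "4 * a 1 = 1 - height a * sum c UNIV"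
    by simp
  have "height a = height (\<lambda>k. a 1 + height a * c k)"
    by (rule arg_cong[OF a])
  also have "\<dots> = 4 * a 1 + height a * height c"
    using assms(1) by (intro height_affine) simp
  finally show "height a * (1 + sum c UNIV - height c) = 1"
    using 1 by (simp add: algebra_simps)
qed

lemma bubble_inj:
  assumes "0 < height a" "sum a UNIV = 1" "0 < height b" "sum b UNIV = 1"
    "bubble a = bubble b"
  shows "a = b"
proof
  fix k
  note A = bubble_recover[OF assms(1,2)] and B = bubble_recover[OF assms(3,4)]
  let ?c = "bubble_shape (bubble b)"
  have "1 + sum ?c UNIV - height ?c \<noteq> 0"
    using B(1) by auto
  moreover have "height a * (1 + sum ?c UNIV - height ?c) = height b * (1 + sum ?c UNIV - height ?c)"
    using A(1) B(1) unfolding assms(5) by simp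
  ultimately have "height a = height b"
    by simp
  moreover from this have "a 1 = b 1"
    using A(2) B(2) assms(5) by simp
  ultimately show "a k = b k"
    using bubble_shape[OF assms(1)] bubble_shape[OF assms(3)] assms(5) by metis
qed

lemma bubble_surj:
  assumes "y \<noteq> 0" "y \<bullet> y = 2 * y $ 1"
  obtains a where "0 < height a" "sum a UNIV = 1" "bubble a = y"
proof -
  define c where "c = bubble_shape y"
  \<comment> \<open>The coefficient of the height in \<open>bubble_recover\<close>, so the height
    has to be \<open>1 / \<kappa>\<close>. It is at least 1, since \<open>height c\<close> is four
    times the least of the four summands.\<close>
  define \<kappa> where "\<kappa> = 1 + sum c UNIV - height c"
  define a where "a k = (1 - sum c UNIV / \<kappa>) / 4 + 1 / \<kappa> * c k" for k
  have y1: "0 < y $ 1"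
    using assms inner_gt_zero_iff[of y] by simp
  have "(\<Sum>k\<in>(UNIV :: 4 set). height c / 4) \<le> (\<Sum>k\<in>UNIV. c k)"
    using height_le[of c] by (intro sum_mono) (simp add: field_simps)
  then have \<kappa>: "0 < \<kappa>"
    by (simp add: \<kappa>_def)
  have "height a = 4 * ((1 - sum c UNIV / \<kappa>) / 4) + 1 / \<kappa> * height c"
    unfolding a_def by (rule height_affine) (use \<kappa> in simp)
  also have "\<dots> = (\<kappa> - sum c UNIV + height c) / \<kappa>"
    using \<kappa> by (simp add: field_simps)
  finally have h: "height a = 1 / \<kappa>"
    by (simp add: \<kappa>_def)
  have suma: "sum a UNIV = 1"
    using \<kappa> by (simp add: a_def sum.distrib flip: sum_divide_distrib) (simp add: field_simps)
  have "bubble_vec a $ k = (1 / (\<kappa> * y $ 1)) * y $ k" for k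
    using y1 \<kappa> h by (simp add: bubble_vec_def a_def c_def bubble_shape_def)
  then have vec: "bubble_vec a = (1 / (\<kappa> * y $ 1)) *\<^sub>R y"
    by (simp add: vec_eq_iff)
  have "bubble_denom a = 2 / (\<kappa>\<^sup>2 * y $ 1)"
    using y1 \<kappa> by (simp add: bubble_denom_def suma vec assms(2) power2_eq_square)
  then have "bubble a = y"
    using y1 \<kappa> by (simp add: bubble_def h vec power2_eq_square)
  moreover have "0 < height a"
    using h \<kappa> by simp
  ultimately show thesis
    using suma that by blast
qed

section \<open>Continuity of the bubble map and equations of the spheres\<close>

lemma continuous_map_height:
  assumes "\<And>k. continuous_map X euclideanreal (\<lambda>x. g x k)"
  shows "continuous_map X euclideanreal (\<lambda>x. height (g x))"
  unfolding height_def using assms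
  by (intro continuous_map_real_mult_left continuous_map_real_Min) auto

lemma continuous_map_bubble:
  assumes "\<And>k. continuous_map X euclideanreal (\<lambda>x. g x k)"
  shows "continuous_map X (euclidean :: (real^4) topology) (\<lambda>x. bubble (g x))"
proof -
  note h = continuous_map_height[OF assms]
  have vk: "continuous_map X euclideanreal (\<lambda>x. bubble_vec (g x) $ k)" for k
    unfolding bubble_vec_def using h assms
    by (cases "k = 1") (auto intro: continuous_map_diff)
  have d: "continuous_map X euclideanreal (\<lambda>x. bubble_denom (g x))"
    unfolding bubble_denom_def inner_vec_def inner_real_def power2_eq_square
    by (intro continuous_map_add continuous_map_sum continuous_map_real_mult continuous_map_diff vk assms)
      auto
  have "bubble_denom (g x) \<noteq> 0" for x
    using bubble_denom_pos[of "g x"] by simp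
  then have "continuous_map X euclideanreal (\<lambda>x. bubble (g x) $ k)" for k
    unfolding bubble_def vector_scaleR_component real_scaleR_def
    by (intro continuous_map_real_mult continuous_map_real_divide continuous_map_real_mult_left vk h d) auto
  then have "\<forall>x\<in>topspace X. ((\<lambda>x. bubble (g x)) \<longlongrightarrow> bubble (g x)) (atin X x)"
    by (auto simp: continuous_map_atin intro!: vec_tendstoI)
  then show ?thesis
    by (simp add: continuous_map_atin)
qed

lemma sphere_through_origin:
  fixes y :: "real^4"
  assumes "0 < r"
  shows "y \<in> sphere (r *\<^sub>R axis 1 1) r \<longleftrightarrow> y \<bullet> y = 2 * r * y $ 1"
proof -
  have "(dist (r *\<^sub>R axis 1 1) y)\<^sup>2 = r\<^sup>2 + y \<bullet> y - 2 * r * y $ 1"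
    unfolding dist_norm power2_norm_eq_inner
    by (simp add: inner_diff_left inner_diff_right inner_axis inner_axis' power2_eq_square algebra_simps inner_commute)
  moreover have "y \<in> sphere (r *\<^sub>R axis 1 1) r \<longleftrightarrow> (dist (r *\<^sub>R axis 1 1) y)\<^sup>2 = r\<^sup>2"
    using assms by (simp add: power2_eq_iff_nonneg)
  ultimately show ?thesis by auto
qed

context finite_complex
begin

text \<open>The realization is a finite union, over the simplices, of compact boxes that are
  degenerate off the simplex, each cut by the closed hyperplane of sum 1.\<close>

lemma compact_space_realization: "compact_space (geom_realization V K)"
proof -
  let ?B = "\<lambda>\<sigma>. \<Pi>\<^sub>E v\<in>V. if v \<in> \<sigma> then {0..1::real} else {0}"
  let ?S = "{f \<in> topspace (powertop_real V). sum f V \<in> {1}}"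
  have cl: "closedin (powertop_real V) ?S"
    by (rule closedin_continuous_map_preimage[where Y = euclideanreal])
       (auto intro!: continuous_intros finite_vertices)
  have "compactin (powertop_real V) (?B \<sigma> \<inter> ?S)" for \<sigma>
    by (rule compact_Int_closedin[OF _ cl]) (auto simp: compactin_PiE)
  then have "compactin (powertop_real V) (\<Union>\<sigma>\<in>K. ?B \<sigma> \<inter> ?S)"
    using finite_simplices by (intro compactin_Union) auto
  moreover have "(\<Union>\<sigma>\<in>K. ?B \<sigma> \<inter> ?S) = topspace (geom_realization V K)"
  proof (intro equalityI subsetI)
    fix f assume "f \<in> (\<Union>\<sigma>\<in>K. ?B \<sigma> \<inter> ?S)"
    then obtain \<sigma> where "\<sigma> \<in> K" "f \<in> ?B \<sigma>" "sum f V = 1" by auto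
    then show "f \<in> topspace (geom_realization V K)"
      by (intro realization_intro[of f \<sigma>]) (auto simp: PiE_iff split: if_splits)
  next
    fix f assume f: "f \<in> topspace (geom_realization V K)"
    have "f v \<le> 1" if "v \<in> V" for v
      using f that member_le_sum[of v V f] finite_vertices by (simp add: topspace_geom_realization)
    then show "f \<in> (\<Union>\<sigma>\<in>K. ?B \<sigma> \<inter> ?S)"
      using f by (intro UN_I[of "{v\<in>V. f v \<noteq> 0}"]) (auto simp: topspace_geom_realization PiE_iff)
  qed
  ultimately show ?thesis
    using topspace_geom_realization[of V K]
    by (simp add: geom_realization_def compact_space_subtopology PiE_UNIV_domain)
qed

end

section \<open>Complexes with tetrahedral facets\<close>

text \<open>\<open>C\<close> holds the cells. \<open>num\<close> numbers them and thereby selects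
  the radius of the target sphere; \<open>b\<close> labels the vertices of a cell by the type
  \<open>4\<close>, on which \<open>bubble\<close> is defined.\<close>

locale tetrahedral_facets = finite_complex +
  fixes C :: "'a set set" and num :: "'a set \<Rightarrow> nat" and b :: "'a set \<Rightarrow> 4 \<Rightarrow> 'a"
  assumes facets: "C \<subseteq> K"
    and maximal: "\<sigma> \<in> C \<Longrightarrow> \<tau> \<in> K \<Longrightarrow> \<sigma> \<subseteq> \<tau> \<Longrightarrow> \<tau> = \<sigma>"
    and bij_b: "\<sigma> \<in> C \<Longrightarrow> bij_betw (b \<sigma>) UNIV \<sigma>"
    and bij_num: "bij_betw num C {1..card C}"
begin

abbreviation X where "X \<equiv> geom_realization V K"
abbreviation Y where "Y \<equiv> geom_realization V (K - C)"

definition coords :: "'a set \<Rightarrow> ('a \<Rightarrow> real) \<Rightarrow> 4 \<Rightarrow> real" where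
  "coords \<sigma> f k = f (b \<sigma> k)"

abbreviation u :: "'a set \<Rightarrow> ('a \<Rightarrow> real) \<Rightarrow> real" where
  "u \<sigma> f \<equiv> height (coords \<sigma> f)"

lemma finite_C: "finite C"
  using facets finite_simplices finite_subset by blast

lemma C_subset_V: "\<sigma> \<in> C \<Longrightarrow> \<sigma> \<subseteq> V"
  using facets simplex_subset by blast

lemma b_in: "\<sigma> \<in> C \<Longrightarrow> b \<sigma> k \<in> \<sigma>"
  using bij_b by (auto simp: bij_betw_def)

lemma finite_complex_remaining: "finite_complex V (K - C)"
proof
  fix \<sigma> \<tau> assume \<sigma>: "\<sigma> \<in> K - C" and \<tau>: "\<tau> \<subseteq> \<sigma>" "\<tau> \<noteq> {}"
  have "\<tau> \<in> K"
    using \<sigma> \<tau> face_closed by blast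
  moreover have "\<tau> \<notin> C"
    using \<sigma> \<tau> maximal by blast
  ultimately show "\<tau> \<in> K - C" by blast
qed (use finite_vertices simplex_subset simplex_nonempty in auto)

lemma Y_subset_X: "topspace Y \<subseteq> topspace X"
  by (auto simp: topspace_geom_realization)

lemma X_nonneg: "f \<in> topspace X \<Longrightarrow> v \<in> V \<Longrightarrow> 0 \<le> f v"
  and X_sum: "f \<in> topspace X \<Longrightarrow> sum f V = 1"
  and X_extensional: "f \<in> topspace X \<Longrightarrow> f \<in> extensional V"
  by (auto simp: topspace_geom_realization PiE_iff)

lemma u_le:
  assumes "\<sigma> \<in> C" "v \<in> \<sigma>"
  shows "u \<sigma> f \<le> 4 * f v"
proof -
  obtain k where "v = b \<sigma> k"
    using assms bij_b[of \<sigma>] by (auto simp: bij_betw_def)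
  then show ?thesis
    using height_le[of "coords \<sigma> f" k] by (simp add: coords_def)
qed

lemma u_attained: "\<sigma> \<in> C \<Longrightarrow> \<exists>v\<in>\<sigma>. u \<sigma> f = 4 * f v"
  using height_attained[of "coords \<sigma> f"] b_in by (auto simp: coords_def)

lemma u_nonneg:
  assumes "f \<in> topspace X" "\<sigma> \<in> C"
  shows "0 \<le> u \<sigma> f"
proof -
  obtain v where "v \<in> \<sigma>" "u \<sigma> f = 4 * f v"
    using u_attained[OF assms(2)] by blast
  moreover from this have "0 \<le> f v"
    using X_nonneg[OF assms(1)] C_subset_V[OF assms(2)] by blast
  ultimately show ?thesis by simp
qed

text \<open>A positive minimum puts all of \<open>\<sigma>\<close> into the support, and maximality
  leaves room for nothing else. Open cells are therefore disjoint, and sums over \<open>C\<close>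
  have at most one nonzero term.\<close>

lemma u_pos_support:
  assumes "f \<in> topspace X" "\<sigma> \<in> C" "0 < u \<sigma> f"
  shows "{v\<in>V. f v \<noteq> 0} = \<sigma>"
proof (rule maximal[OF \<open>\<sigma> \<in> C\<close>])
  show "{v\<in>V. f v \<noteq> 0} \<in> K"
    using assms by (simp add: topspace_geom_realization)
  show "\<sigma> \<subseteq> {v\<in>V. f v \<noteq> 0}"
    using u_le[OF \<open>\<sigma> \<in> C\<close>, of _ f] assms(3) C_subset_V[OF \<open>\<sigma> \<in> C\<close>] by force
qed

lemma u_zero_other:
  assumes "f \<in> topspace X" "\<sigma> \<in> C" "0 < u \<sigma> f" "\<tau> \<in> C" "\<tau> \<noteq> \<sigma>"
  shows "u \<tau> f = 0"
  using u_pos_support[OF assms(1-3)] u_pos_support[OF assms(1,4)] u_nonneg[OF assms(1,4)] assms(5)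
  by fastforce

lemma Y_iff:
  assumes "f \<in> topspace X"
  shows "f \<in> topspace Y \<longleftrightarrow> (\<forall>\<sigma>\<in>C. u \<sigma> f = 0)"
proof -
  have "f \<in> topspace Y \<longleftrightarrow> {v\<in>V. f v \<noteq> 0} \<notin> C"
    using assms by (auto simp: topspace_geom_realization)
  also have "\<dots> \<longleftrightarrow> (\<forall>\<sigma>\<in>C. u \<sigma> f = 0)"
  proof
    assume *: "{v\<in>V. f v \<noteq> 0} \<notin> C"
    show "\<forall>\<sigma>\<in>C. u \<sigma> f = 0"
    proof
      fix \<sigma> assume "\<sigma> \<in> C"
      then have "\<not> 0 < u \<sigma> f"
        using u_pos_support[OF assms \<open>\<sigma> \<in> C\<close>] * by auto
      then show "u \<sigma> f = 0"
        using u_nonneg[OF assms \<open>\<sigma> \<in> C\<close>] by simp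
    qed
  next
    assume 0: "\<forall>\<sigma>\<in>C. u \<sigma> f = 0"
    show "{v\<in>V. f v \<noteq> 0} \<notin> C"
    proof
      assume "{v\<in>V. f v \<noteq> 0} \<in> C"
      then show False
        using 0 u_attained[of "{v\<in>V. f v \<noteq> 0}" f] by auto
    qed
  qed
  finally show ?thesis .
qed

lemma X_cases:
  assumes "f \<in> topspace X"
  obtains (rest) "f \<in> topspace Y" "\<And>\<sigma>. \<sigma> \<in> C \<Longrightarrow> u \<sigma> f = 0"
  | (cell) \<sigma> where "\<sigma> \<in> C" "0 < u \<sigma> f" "{v\<in>V. f v \<noteq> 0} = \<sigma>" "sum f \<sigma> = 1"
      "\<And>\<tau>. \<tau> \<in> C \<Longrightarrow> \<tau> \<noteq> \<sigma> \<Longrightarrow> u \<tau> f = 0"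
proof (cases "\<forall>\<sigma>\<in>C. u \<sigma> f = 0")
  case True
  then show ?thesis
    using rest assms Y_iff by blast
next
  case False
  then obtain \<sigma> where \<sigma>: "\<sigma> \<in> C" "u \<sigma> f \<noteq> 0"
    by blast
  then have "0 < u \<sigma> f"
    using u_nonneg[OF assms \<sigma>(1)] by linarith
  note \<sigma> = \<sigma>(1) this
  have s: "{v\<in>V. f v \<noteq> 0} = \<sigma>"
    using u_pos_support assms \<sigma> by blast
  have "sum f \<sigma> = sum f V"
    using s finite_vertices by (intro sum.mono_neutral_left) auto
  then show ?thesis
    using cell[OF \<sigma> s] u_zero_other[OF assms \<sigma>] X_sum assms by simp
qed

section \<open>The quotient map onto the wedge\<close>

definition collapse :: "('a \<Rightarrow> real) \<Rightarrow> real^4" where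
  "collapse f = (\<Sum>\<sigma>\<in>C. real (num \<sigma>) *\<^sub>R bubble (coords \<sigma> f))"

lemma sum_C_single:
  fixes g :: "'a set \<Rightarrow> 'b::comm_monoid_add"
  assumes "\<sigma> \<in> C" "\<And>\<tau>. \<tau> \<in> C \<Longrightarrow> \<tau> \<noteq> \<sigma> \<Longrightarrow> g \<tau> = 0"
  shows "sum g C = g \<sigma>"
  using assms finite_C by (simp add: sum.remove[of C \<sigma>])

lemma collapse_rest:
  assumes "f \<in> topspace Y"
  shows "collapse f = 0"
proof -
  have "bubble (coords \<sigma> f) = 0" if "\<sigma> \<in> C" for \<sigma>
    using assms Y_iff Y_subset_X that by (intro bubble_eq_0) blast
  then show ?thesis
    by (simp add: collapse_def)
qed

lemma collapse_cell:
  assumes "f \<in> topspace X" "\<sigma> \<in> C" "0 < u \<sigma> f"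
  shows "collapse f = real (num \<sigma>) *\<^sub>R bubble (coords \<sigma> f)"
  unfolding collapse_def
  by (rule sum_C_single[OF assms(2)]) (simp add: bubble_eq_0 u_zero_other[OF assms])

lemma sum_coords:
  assumes "\<sigma> \<in> C"
  shows "sum (coords \<sigma> f) UNIV = sum f \<sigma>"
  unfolding coords_def using sum.reindex_bij_betw[OF bij_b[OF assms]] by blast

lemma num_range: "\<sigma> \<in> C \<Longrightarrow> num \<sigma> \<in> {1..card C}"
  using bij_num by (auto simp: bij_betw_def)

lemma collapse_cell_sphere:
  assumes "f \<in> topspace X" "\<sigma> \<in> C" "0 < u \<sigma> f"
  shows "collapse f \<bullet> collapse f = 2 * real (num \<sigma>) * collapse f $ 1" "0 < collapse f $ 1"
proof -
  have "sum (coords \<sigma> f) UNIV = 1"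
  using assms(1) proof (cases f rule: X_cases)
    case rest
    then show ?thesis
      using rest(2)[OF assms(2)] assms(3) by simp
  next
    case (cell \<tau>)
    have "\<sigma> = \<tau>"
      using cell(5)[OF assms(2)] assms(3) by linarith
    then show ?thesis
      using cell(4) sum_coords[OF assms(2)] by simp
  qed
  from bubble_inner[OF this] show "collapse f \<bullet> collapse f = 2 * real (num \<sigma>) * collapse f $ 1"
    by (simp add: collapse_cell[OF assms])
  show "0 < collapse f $ 1"
    using bubble_1_pos[OF assms(3)] num_range[OF assms(2)] by (simp add: collapse_cell[OF assms])
qed

text \<open>A value y with positive first entry reveals its cell through y . y = 2 * num * y_1;
  inside one cell \<open>bubble_inj\<close> applies. All of \<open>Y\<close> goes to the origin,
  whose first entry is 0.\<close>

lemma collapse_inj: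
  assumes "f \<in> topspace X" "g \<in> topspace X" "collapse f = collapse g"
  shows "f = g \<or> f \<in> topspace Y \<and> g \<in> topspace Y"
using assms(1) proof (cases f rule: X_cases)
  case rest
  have "collapse g = 0"
    using collapse_rest[OF rest(1)] assms(3) by simp
  have "g \<in> topspace Y"
  using assms(2) proof (cases g rule: X_cases)
    case (cell \<sigma>)
    then show ?thesis
      using collapse_cell_sphere(2)[OF assms(2) cell(1,2)] \<open>collapse g = 0\<close> by simp
  qed
  then show ?thesis
    using rest(1) by blast
next
  case f: (cell \<sigma>)
  show ?thesis
  using assms(2) proof (cases g rule: X_cases)
    case rest
    then show ?thesis
      using collapse_rest collapse_cell_sphere(2)[OF assms(1) f(1,2)] assms(3) by simp
  next
    case g: (cell \<tau>)
    have "num \<sigma> = num \<tau>"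
      using collapse_cell_sphere[OF assms(1) f(1,2)] collapse_cell_sphere[OF assms(2) g(1,2)] assms(3)
      by simp
    then have \<tau>: "\<tau> = \<sigma>"
      using bij_num f(1) g(1) by (auto simp: bij_betw_def inj_on_def)
    have "bubble (coords \<sigma> f) = bubble (coords \<sigma> g)"
      using collapse_cell[OF assms(1) f(1,2)] collapse_cell[OF assms(2) g(1,2)] assms(3) \<tau>
        num_range[OF f(1)] by simp
    then have c: "coords \<sigma> f = coords \<sigma> g"
      using f g \<tau> by (intro bubble_inj) (auto simp: sum_coords)
    have "f v = g v" for v
    proof (cases "v \<in> \<sigma>")
      case True
      then obtain k where "v = b \<sigma> k"
        using bij_b[OF f(1)] by (auto simp: bij_betw_def)
      then show ?thesis
        using fun_cong[OF c, of k] by (simp add: coords_def)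
    next
      case False
      then show ?thesis
        using f(3) g(3) \<tau> X_extensional[OF assms(1)] X_extensional[OF assms(2)]
        by (cases "v \<in> V") (auto simp: extensional_def)
    qed
    then show ?thesis by blast
  qed
qed

lemma topspace_wedge_S3:
  "y \<in> topspace (wedge_S3 k) \<longleftrightarrow> y = 0 \<or> (\<exists>i\<in>{1..k}. y \<bullet> y = 2 * real i * y $ 1)"
proof -
  have "y \<in> sphere (real i *\<^sub>R axis 1 1) (real i) \<longleftrightarrow> y \<bullet> y = 2 * real i * y $ 1" if "i \<in> {1..k}" for i
    using that by (intro sphere_through_origin) simp
  then show ?thesis
    unfolding wedge_S3_def topspace_euclidean_subtopology by blast
qed

lemma collapse_image:
  assumes "K - C \<noteq> {}"
  shows "collapse ` topspace X = topspace (wedge_S3 (card C))"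
proof (intro equalityI subsetI)
  fix y assume "y \<in> collapse ` topspace X"
  then obtain f where f: "f \<in> topspace X" "y = collapse f" by blast
  show "y \<in> topspace (wedge_S3 (card C))"
  using f(1) proof (cases f rule: X_cases)
    case rest
    then show ?thesis
      using collapse_rest[OF rest(1)] f(2) by (simp add: topspace_wedge_S3)
  next
    case (cell \<sigma>)
    then show ?thesis
      using f collapse_cell_sphere(1)[OF f(1) cell(1,2)] num_range[OF cell(1)] unfolding topspace_wedge_S3 by blast
  qed
next
  fix y assume y: "y \<in> topspace (wedge_S3 (card C))"
  show "y \<in> collapse ` topspace X"
  proof (cases "y = 0")
    case True
    \<comment> \<open>Open cells have images with positive first entry, so the base point is reached
      only from a remaining simplex; a vertex of one serves.\<close>
    obtain \<sigma> where "\<sigma> \<in> K - C" using assms by blast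
    then obtain v where v: "v \<in> \<sigma>"
      using simplex_nonempty by blast
    interpret Y: finite_complex V "K - C" by (rule finite_complex_remaining)
    have "v \<in> V" using v \<open>\<sigma> \<in> K - C\<close> simplex_subset by blast
    then have Y: "restrict (\<lambda>w. if w = v then 1 else 0) V \<in> topspace Y"
      using v finite_vertices \<open>\<sigma> \<in> K - C\<close>
      by (intro Y.realization_intro[of _ \<sigma>]) auto
    show ?thesis
      using collapse_rest[OF Y] subsetD[OF Y_subset_X Y] unfolding True by (rule image_eqI[OF sym])
  next
    case False
    then obtain i where i: "i \<in> {1..card C}" "y \<bullet> y = 2 * real i * y $ 1"
      using y by (auto simp: topspace_wedge_S3)
    then obtain \<sigma> where \<sigma>: "\<sigma> \<in> C" "num \<sigma> = i"
      using bij_num by (metis bij_betw_def imageE)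
    \<comment> \<open>Scaling by the inverse radius moves the sphere of radius \<open>i\<close> to
      the unit sphere, which lies in the range of \<open>bubble\<close>.\<close>
    define y' where "y' = (1 / real i) *\<^sub>R y"
    have "y' \<noteq> 0" "y' \<bullet> y' = 2 * y' $ 1"
      using False i by (auto simp: y'_def)
    then obtain a where a: "0 < height a" "sum a UNIV = 1" "bubble a = y'"
      by (rule bubble_surj)
    define f where "f = restrict (\<lambda>v. if v \<in> \<sigma> then a (inv_into UNIV (b \<sigma>) v) else 0) V"
    have ca: "coords \<sigma> f = a"
    proof
      fix k
      have "b \<sigma> k \<in> V" "b \<sigma> k \<in> \<sigma>"
        using b_in[OF \<sigma>(1)] C_subset_V[OF \<sigma>(1)] by auto
      moreover have "inv_into UNIV (b \<sigma>) (b \<sigma> k) = k"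
        using bij_b[OF \<sigma>(1)] by (simp add: bij_betw_def)
      ultimately show "coords \<sigma> f k = a k"
        by (simp add: coords_def f_def)
    qed
    have apos: "0 < a k" for k
      using height_le[of a k] a(1) by simp
    have "f \<in> topspace X"
    proof (rule realization_intro)
      have "sum f V = sum f \<sigma>"
        using C_subset_V[OF \<sigma>(1)] finite_vertices by (intro sum.mono_neutral_right) (auto simp: f_def)
      then show "sum f V = 1"
        using sum_coords[OF \<sigma>(1), of f] ca a(2) by simp
      show "\<sigma> \<in> K" using \<sigma>(1) facets by blast
    qed (use apos in \<open>auto simp: f_def less_imp_le\<close>)
    moreover have "collapse f = y"
      using collapse_cell[OF \<open>f \<in> topspace X\<close> \<sigma>(1)] ca a \<sigma>(2) i(1) by (simp add: y'_def)
    ultimately show ?thesis by blast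
  qed
qed

lemma continuous_map_coords:
  assumes "\<sigma> \<in> C" "\<And>v. v \<in> V \<Longrightarrow> continuous_map Z euclideanreal (\<lambda>x. g x v)"
  shows "continuous_map Z euclideanreal (\<lambda>x. coords \<sigma> (g x) k)"
  using assms b_in[OF assms(1)] C_subset_V[OF assms(1)] by (auto simp: coords_def)

lemma continuous_map_u:
  assumes "\<sigma> \<in> C" "\<And>v. v \<in> V \<Longrightarrow> continuous_map Z euclideanreal (\<lambda>x. g x v)"
  shows "continuous_map Z euclideanreal (\<lambda>x. u \<sigma> (g x))"
  by (rule continuous_map_height) (rule continuous_map_coords[OF assms])

lemma continuous_map_collapse:
  assumes "K - C \<noteq> {}"
  shows "continuous_map X (wedge_S3 (card C)) collapse"
proof -
  have "continuous_map X euclidean (\<lambda>f. real (num \<sigma>) *\<^sub>R bubble (coords \<sigma> f))" if "\<sigma> \<in> C" for \<sigma>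
  proof -
    have "continuous_map X euclidean (\<lambda>f. bubble (coords \<sigma> f))"
      using that by (intro continuous_map_bubble continuous_map_coords continuous_map_geom_realization_coordinate)
    then have "continuous_map X euclidean ((\<lambda>y. real (num \<sigma>) *\<^sub>R y) \<circ> (\<lambda>f. bubble (coords \<sigma> f)))"
      by (rule continuous_map_compose) (auto intro!: continuous_intros)
    then show ?thesis
      by (simp add: o_def)
  qed
  then have "continuous_map X euclidean collapse"
    unfolding collapse_def by (intro continuous_map_sum finite_C)
  then show ?thesis
    using collapse_image[OF assms]
    by (auto simp: wedge_S3_def continuous_map_in_subtopology)
qed

lemma quotient_map_collapse:
  assumes "K - C \<noteq> {}"
  shows "quotient_map X (wedge_S3 (card C)) collapse"
  by (rule continuous_imp_quotient_map[OF continuous_map_collapse[OF assms] compact_space_realization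
        _ collapse_image[OF assms]])
     (simp add: wedge_S3_def Hausdorff_space_subtopology)

text \<open>The product of a quotient map with an identity need not be a quotient map in general;
  here compactness and the Hausdorff property give it directly. It lets a homotopy descend to the
  wedge.\<close>

lemma quotient_map_collapse_cylinder:
  assumes "K - C \<noteq> {}"
  shows "quotient_map (prod_topology (top_of_set {0..1::real}) X)
    (prod_topology (top_of_set {0..1}) (wedge_S3 (card C))) (\<lambda>(s, f). (s, collapse f))"
proof (rule continuous_imp_quotient_map)
  show "continuous_map (prod_topology (top_of_set {0..1::real}) X)
    (prod_topology (top_of_set {0..1}) (wedge_S3 (card C))) (\<lambda>(s, f). (s, collapse f))"
    using continuous_map_prod_top[of "top_of_set {0..1::real}" X "top_of_set {0..1::real}" "wedge_S3 (card C)" id collapse]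
      continuous_map_collapse[OF assms] by simp
  show "compact_space (prod_topology (top_of_set {0..1::real}) X)"
    by (simp add: compact_space_prod_topology compact_space_realization compact_space_subtopology)
  show "Hausdorff_space (prod_topology (top_of_set {0..1::real}) (wedge_S3 (card C)))"
    by (simp add: Hausdorff_space_prod_topology wedge_S3_def Hausdorff_space_subtopology)
  show "(\<lambda>(s, f). (s, collapse f)) ` topspace (prod_topology (top_of_set {0..1::real}) X) =
      topspace (prod_topology (top_of_set {0..1}) (wedge_S3 (card C)))"
    using collapse_image[OF assms] by (simp flip: map_prod_def add: map_prod_surj_on)
qed

end

section \<open>Extending a contraction over the cells\<close>

context tetrahedral_facets
begin

text \<open>In a cell the smallest coordinate \<open>u \<sigma> f / 4\<close> is taken from each of
  the four vertices. The rest has mass \<open>1 - depth f\<close>; normalised, it is the radial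
  projection \<open>push f\<close> from the barycenter to the boundary. The depth is 0 on the
  boundary and 1 at the barycenter.\<close>

definition hollow :: "('a \<Rightarrow> real) \<Rightarrow> 'a \<Rightarrow> real" where
  "hollow f v = f v - (\<Sum>\<sigma>\<in>C. u \<sigma> f * (if v \<in> \<sigma> then 1/4 else 0))"

definition depth :: "('a \<Rightarrow> real) \<Rightarrow> real" where
  "depth f = (\<Sum>\<sigma>\<in>C. u \<sigma> f)"

definition push :: "('a \<Rightarrow> real) \<Rightarrow> 'a \<Rightarrow> real" where
  "push f = restrict (\<lambda>v. hollow f v / (1 - depth f)) V"

text \<open>A point of depth d in a cell is (1 - d) p + d c with p on the boundary and c the
  barycenter; here d is replaced by d - s/2 and the result rescaled. On the core d \<ge> s/2 the
  \<open>max\<close> changes nothing for the cell itself and removes the terms of all other cells.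
  Using s/2 rather than s keeps \<open>1 - s / 2\<close>, and \<open>1 - depth f\<close> outside the
  core, positive up to time 1.\<close>

definition stretch :: "real \<Rightarrow> ('a \<Rightarrow> real) \<Rightarrow> 'a \<Rightarrow> real" where
  "stretch s f = restrict (\<lambda>v. (hollow f v +
     (\<Sum>\<sigma>\<in>C. max 0 (u \<sigma> f - s / 2) * (if v \<in> \<sigma> then 1/4 else 0))) / (1 - s / 2)) V"

lemma continuous_map_hollow:
  assumes "\<And>v. v \<in> V \<Longrightarrow> continuous_map Z euclideanreal (\<lambda>x. g x v)" "v \<in> V"
  shows "continuous_map Z euclideanreal (\<lambda>x. hollow (g x) v)"
  unfolding hollow_def
  by (intro continuous_map_diff continuous_map_sum finite_C continuous_map_real_mult
      continuous_map_canonical_const continuous_map_u assms)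

lemma continuous_map_depth:
  assumes "\<And>v. v \<in> V \<Longrightarrow> continuous_map Z euclideanreal (\<lambda>x. g x v)"
  shows "continuous_map Z euclideanreal (\<lambda>x. depth (g x))"
  unfolding depth_def
  by (intro continuous_map_sum finite_C continuous_map_u assms)

lemma depth_rest:
  assumes "\<And>\<sigma>. \<sigma> \<in> C \<Longrightarrow> u \<sigma> f = 0"
  shows "depth f = 0" "hollow f = f"
  using assms by (auto simp: depth_def hollow_def fun_eq_iff)

lemma depth_cell:
  assumes "\<sigma> \<in> C" "\<And>\<tau>. \<tau> \<in> C \<Longrightarrow> \<tau> \<noteq> \<sigma> \<Longrightarrow> u \<tau> f = 0"
  shows "depth f = u \<sigma> f" "hollow f v = (if v \<in> \<sigma> then f v - u \<sigma> f / 4 else f v)"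
proof -
  show "depth f = u \<sigma> f"
    unfolding depth_def using assms by (rule sum_C_single)
  have "(\<Sum>\<tau>\<in>C. u \<tau> f * (if v \<in> \<tau> then 1/4 else 0)) = u \<sigma> f * (if v \<in> \<sigma> then 1/4 else 0)"
    using assms(1) by (rule sum_C_single) (simp add: assms(2))
  then show "hollow f v = (if v \<in> \<sigma> then f v - u \<sigma> f / 4 else f v)"
    by (simp add: hollow_def)
qed

lemma depth_nonneg: "f \<in> topspace X \<Longrightarrow> 0 \<le> depth f"
  unfolding depth_def using u_nonneg by (intro sum_nonneg)

lemma push_rest:
  assumes "f \<in> topspace Y"
  shows "depth f = 0" "push f = f"
proof -
  have 0: "u \<sigma> f = 0" if "\<sigma> \<in> C" for \<sigma>
    using assms that Y_iff Y_subset_X by blast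
  show "depth f = 0"
    using 0 by (rule depth_rest)
  then show "push f = f"
    using depth_rest(2)[OF 0] X_extensional[of f] subsetD[OF Y_subset_X assms]
    by (simp add: push_def extensional_restrict)
qed

lemma card_C:
  assumes "\<sigma> \<in> C"
  shows "card \<sigma> = 4"
  using bij_betw_same_card[OF bij_b[OF assms]] by simp

lemma sum_V_cell:
  fixes g :: "'a \<Rightarrow> real"
  assumes "\<sigma> \<in> C" "\<And>v. v \<in> V \<Longrightarrow> v \<notin> \<sigma> \<Longrightarrow> g v = 0"
  shows "sum g V = sum g \<sigma>"
  using assms C_subset_V[OF assms(1)] finite_vertices by (intro sum.mono_neutral_right) auto

text \<open>The vertex at which the minimum is attained gets coordinate 0, so the image lies on a
  proper face of the cell, and by maximality no proper face of a cell is again in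
  \<open>C\<close>.\<close>

lemma push_in_Y:
  assumes f: "f \<in> topspace X" and d: "depth f < 1"
  shows "push f \<in> topspace Y"
  using f
proof (cases f rule: X_cases)
  case rest
  then show ?thesis
    using push_rest by simp
next
  case (cell \<sigma>)
  note dp = depth_cell[OF cell(1,5)]
  interpret Y: finite_complex V "K - C" by (rule finite_complex_remaining)
  obtain w where w: "w \<in> \<sigma>" "u \<sigma> f = 4 * f w"
    using u_attained[OF cell(1)] by blast
  have f0: "f v = 0" if "v \<in> V" "v \<notin> \<sigma>" for v
    using cell(3) that by blast
  have "\<sigma> \<noteq> {w}"
    using card_C[OF cell(1)] by auto
  then have ne: "\<sigma> - {w} \<noteq> {}"
    using w by blast
  have "\<sigma> - {w} \<in> K"
    using face_closed[of \<sigma> "\<sigma> - {w}"] facets cell(1) ne by blast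
  moreover have "\<sigma> - {w} \<notin> C"
    using maximal[of "\<sigma> - {w}" \<sigma>] facets cell(1) w by blast
  ultimately have face: "\<sigma> - {w} \<in> K - C" by blast
  show ?thesis
  proof (rule Y.realization_intro[OF _ _ _ face])
    show "push f \<in> extensional V"
      by (simp add: push_def)
    show "0 \<le> push f v" if "v \<in> V" for v
    proof -
      have "0 \<le> hollow f v"
        using u_le[OF cell(1), of v f] X_nonneg[OF f that] by (simp add: dp mult.commute)
      then show ?thesis
        using d that by (simp add: push_def)
    qed
    show "push f v = 0" if "v \<in> V - (\<sigma> - {w})" for v
      using that w f0 by (auto simp: push_def dp)
    have "sum (hollow f) V = sum (hollow f) \<sigma>"
      using f0 by (intro sum_V_cell[OF cell(1)]) (auto simp: dp)
    also have "\<dots> = sum f \<sigma> - u \<sigma> f"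
      by (simp add: dp sum_subtractf card_C[OF cell(1)])
    also have "\<dots> = 1 - depth f"
      using cell(4) by (simp add: dp)
    finally have "sum (hollow f) V = 1 - depth f" .
    then show "sum (push f) V = 1"
      using d by (simp add: push_def flip: sum_divide_distrib)
  qed
qed

lemma stretch_in_X:
  assumes f: "f \<in> topspace X" and s: "0 \<le> s" "s \<le> 1" "s / 2 \<le> depth f"
  shows "stretch s f \<in> topspace X"
  using f
proof (cases f rule: X_cases)
  case rest
  then have "s = 0"
    using s depth_rest[of f] by simp
  then have "stretch s f = f"
    using rest(2) depth_rest(2)[OF rest(2)] X_extensional[OF f]
    by (simp add: stretch_def extensional_restrict)
  then show ?thesis
    using f by simp
next
  case (cell \<sigma>)
  note dp = depth_cell[OF cell(1,5)]
  have f0: "f v = 0" if "v \<in> V" "v \<notin> \<sigma>" for v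
    using cell(3) that by blast
  have "\<sigma> \<in> K"
    using cell(1) facets by blast
  let ?m = "u \<sigma> f - s / 2"
  have m: "0 \<le> ?m"
    using s(3) dp(1) by simp
  have "(\<Sum>\<tau>\<in>C. max 0 (u \<tau> f - s / 2) * (if v \<in> \<tau> then 1/4 else 0)) = ?m * (if v \<in> \<sigma> then 1/4 else 0)" for v
  proof -
    have "(\<Sum>\<tau>\<in>C. max 0 (u \<tau> f - s / 2) * (if v \<in> \<tau> then 1/4 else 0))
       = max 0 (u \<sigma> f - s / 2) * (if v \<in> \<sigma> then 1/4 else 0)"
      using cell(1) by (rule sum_C_single) (simp add: cell(5) s(1))
    then show ?thesis
      using m by simp
  qed
  then have st: "stretch s f v = (hollow f v + ?m * (if v \<in> \<sigma> then 1/4 else 0)) / (1 - s / 2)" if "v \<in> V" for v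
    using that by (simp add: stretch_def)
  show ?thesis
  proof (rule realization_intro[OF _ _ _ \<open>\<sigma> \<in> K\<close>])
    show "stretch s f \<in> extensional V"
      by (simp add: stretch_def)
    show "0 \<le> stretch s f v" if "v \<in> V" for v
    proof -
      have "0 \<le> hollow f v"
        using u_le[OF cell(1), of v f] X_nonneg[OF f that] by (simp add: dp mult.commute)
      then show ?thesis
        using s m unfolding st[OF that] by (intro divide_nonneg_nonneg add_nonneg_nonneg mult_nonneg_nonneg) auto
    qed
    show "stretch s f v = 0" if "v \<in> V - \<sigma>" for v
      using that f0 by (simp add: st dp)
    then have "sum (stretch s f) V = sum (stretch s f) \<sigma>"
      by (intro sum_V_cell[OF cell(1)]) auto
    also have "\<dots> = (\<Sum>v\<in>\<sigma>. (f v - u \<sigma> f / 4 + ?m * (1/4)) / (1 - s / 2))"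
      using C_subset_V[OF cell(1)] by (intro sum.cong) (auto simp: st dp)
    also have "\<dots> = (sum f \<sigma> - u \<sigma> f + ?m) / (1 - s / 2)"
      by (simp add: sum.distrib sum_subtractf card_C[OF cell(1)] flip: sum_divide_distrib)
        (simp add: field_simps)
    also have "\<dots> = 1"
      using cell(4) s by simp
    finally show "sum (stretch s f) V = 1" .
  qed
qed

text \<open>At depth exactly \<open>s / 2\<close> nothing of the barycenter is left. This is the
  matching condition for pasting the two halves of the homotopy.\<close>

lemma stretch_eq_push:
  assumes f: "f \<in> topspace X" and s: "depth f = s / 2"
  shows "stretch s f = push f"
proof -
  have "max 0 (u \<sigma> f - s / 2) = 0" if "\<sigma> \<in> C" for \<sigma>
  proof -
    have "u \<sigma> f \<le> depth f"
      unfolding depth_def using that u_nonneg[OF f] finite_C by (intro member_le_sum) auto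
    then show ?thesis
      using s by simp
  qed
  then have "(\<Sum>\<sigma>\<in>C. max 0 (u \<sigma> f - s / 2) * (if v \<in> \<sigma> then 1/4 else 0)) = 0" for v
    by simp
  then show ?thesis
    unfolding stretch_def push_def s by simp
qed

lemma stretch_0:
  assumes f: "f \<in> topspace X"
  shows "stretch 0 f = f"
proof -
  have "(\<Sum>\<sigma>\<in>C. max 0 (u \<sigma> f - 0 / 2) * (if v \<in> \<sigma> then 1/4 else 0)) =
      (\<Sum>\<sigma>\<in>C. u \<sigma> f * (if v \<in> \<sigma> then 1/4 else 0))" for v
    using u_nonneg[OF f] by (intro sum.cong) auto
  then have "stretch 0 f = restrict f V"
    by (simp add: stretch_def hollow_def)
  then show ?thesis
    using X_extensional[OF f] by (simp add: extensional_restrict)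
qed

text \<open>Homotopy extension by hand: in a cell the concentric layers up to relative depth \<open>s / 2\<close> are
  pushed to the boundary and follow the contraction there, while the remaining core is blown up to
  fill the whole cell.\<close>

lemma extend_contraction:
  assumes H: "continuous_map (prod_topology (top_of_set {0..1::real}) Y) Y H"
    and H0: "\<And>f. f \<in> topspace Y \<Longrightarrow> H (0, f) = f"
    and H1: "\<And>f. f \<in> topspace Y \<Longrightarrow> H (1, f) = a"
  obtains h where "continuous_map (prod_topology (top_of_set {0..1::real}) X) X h"
    "\<And>f. f \<in> topspace X \<Longrightarrow> h (0, f) = f"
    "\<And>s f. s \<in> {0..1} \<Longrightarrow> f \<in> topspace Y \<Longrightarrow> h (s, f) \<in> topspace Y"
    "\<And>f. f \<in> topspace Y \<Longrightarrow> h (1, f) = a"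
proof
  let ?IX = "prod_topology (top_of_set {0..1::real}) X"
  let ?p = "\<lambda>x. depth (snd x)" and ?q = "\<lambda>x. fst x / 2"
  \<comment> \<open>The layer of depth d reaches the boundary at time 2d and follows
    \<open>H\<close> for the remaining time s - 2d. On \<open>Y\<close> the depth is 0, so there
    \<open>h\<close> is \<open>H\<close> itself.\<close>
  define h where "h x = (if ?p x \<le> ?q x then H (fst x - 2 * depth (snd x), push (snd x)) else stretch (fst x) (snd x))"
    for x :: "real \<times> ('a \<Rightarrow> real)"
  have cv: "continuous_map ?IX euclideanreal (\<lambda>x. snd x v)" if "v \<in> V" for v
    using continuous_map_compose[OF continuous_map_snd continuous_map_geom_realization_coordinate[OF that]]
    by (simp add: o_def)
  have cf: "continuous_map ?IX euclideanreal fst"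
    by (metis continuous_map_fst continuous_map_into_fulltopology)
  have cp: "continuous_map ?IX euclideanreal ?p"
    by (intro continuous_map_depth cv)
  have cq: "continuous_map ?IX euclideanreal ?q"
    by (intro continuous_map_real_divide cf) auto
  let ?A = "subtopology ?IX {x \<in> topspace ?IX. ?p x \<le> ?q x}"
  let ?B = "subtopology ?IX {x \<in> topspace ?IX. ?q x \<le> ?p x}"
  have H_in: "H (s, f) \<in> topspace Y" if "s \<in> {0..1}" "f \<in> topspace Y" for s f
    using continuous_map_funspace[OF H] that by auto
  have "continuous_map ?A Y (\<lambda>x. push (snd x))"
    unfolding continuous_map_geom_realization
  proof (intro conjI ballI)
    show "(\<lambda>x. push (snd x)) \<in> topspace ?A \<rightarrow> topspace Y"
      by (auto intro!: push_in_Y)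
    fix v assume v: "v \<in> V"
    have "continuous_map ?A euclideanreal (\<lambda>x. hollow (snd x) v / (1 - depth (snd x)))"
    proof (rule continuous_map_real_divide)
      show "continuous_map ?A euclideanreal (\<lambda>x. hollow (snd x) v)"
        by (rule continuous_map_from_subtopology, rule continuous_map_hollow[OF cv v])
      show "continuous_map ?A euclideanreal (\<lambda>x. 1 - depth (snd x))"
        by (rule continuous_map_from_subtopology) (intro continuous_map_diff cp continuous_map_canonical_const)
    qed auto
    then show "continuous_map ?A euclideanreal (\<lambda>x. push (snd x) v)"
      using v by (simp add: push_def)
  qed
  moreover have "continuous_map ?A (top_of_set {0..1::real}) (\<lambda>x. fst x - 2 * depth (snd x))"
  proof -
    have "continuous_map ?A euclideanreal (\<lambda>x. fst x - 2 * depth (snd x))"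
      by (rule continuous_map_from_subtopology) (intro continuous_map_diff continuous_map_real_mult_left cf cp)
    then show ?thesis
      using depth_nonneg by (fastforce simp: continuous_map_in_subtopology)
  qed
  ultimately have "continuous_map ?A (prod_topology (top_of_set {0..1::real}) Y)
      (\<lambda>x. (fst x - 2 * depth (snd x), push (snd x)))"
    by (simp add: continuous_map_paired)
  from continuous_map_compose[OF this H]
  have cA: "continuous_map ?A Y (\<lambda>x. H (fst x - 2 * depth (snd x), push (snd x)))"
    by (simp add: o_def)
  have incl: "continuous_map Y X id"
    using Y_subset_X continuous_map_geom_realization_coordinate
    by (auto simp: continuous_map_geom_realization)
  have cA: "continuous_map ?A X (\<lambda>x. H (fst x - 2 * depth (snd x), push (snd x)))"
    using continuous_map_compose[OF cA incl] by (simp add: o_def)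
  have cB: "continuous_map ?B X (\<lambda>x. stretch (fst x) (snd x))"
    unfolding continuous_map_geom_realization
  proof (intro conjI ballI)
    show "(\<lambda>x. stretch (fst x) (snd x)) \<in> topspace ?B \<rightarrow> topspace X"
      by (auto intro!: stretch_in_X)
    fix v assume v: "v \<in> V"
    have "continuous_map ?IX euclideanreal (\<lambda>x. (hollow (snd x) v +
       (\<Sum>\<sigma>\<in>C. max 0 (u \<sigma> (snd x) - fst x / 2) * (if v \<in> \<sigma> then 1/4 else 0))) / (1 - fst x / 2))"
      by (intro continuous_map_real_divide continuous_map_add continuous_map_sum finite_C
        continuous_map_real_mult continuous_map_real_max continuous_map_diff continuous_map_canonical_const
        continuous_map_hollow continuous_map_u cv cq v) auto
    then show "continuous_map ?B euclideanreal (\<lambda>x. stretch (fst x) (snd x) v)"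
      using v by (simp add: stretch_def continuous_map_from_subtopology)
  qed
  show "continuous_map ?IX X h"
    unfolding h_def
  proof (rule continuous_map_cases_le[OF cp cq cA cB])
    fix x assume x: "x \<in> topspace ?IX" "?p x = ?q x"
    then have X: "snd x \<in> topspace X" and "0 \<le> fst x" "fst x \<le> 1" by auto
    then have "push (snd x) \<in> topspace Y"
      using x(2) by (intro push_in_Y) auto
    moreover have e: "fst x - 2 * depth (snd x) = 0"
      using x(2) by simp
    ultimately show "H (fst x - 2 * depth (snd x), push (snd x)) = stretch (fst x) (snd x)"
      unfolding e stretch_eq_push[OF X x(2)] by (intro H0)
  qed
  show "h (0, f) = f" if "f \<in> topspace X" for f
  proof (cases "depth f = 0")
    case True
    then have "push f \<in> topspace Y" "push f = f"
      using push_in_Y[OF that] stretch_eq_push[OF that, of 0] stretch_0[OF that] by auto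
    then show ?thesis
      using True H0 by (simp add: h_def)
  next
    case False
    then show ?thesis
      using depth_nonneg[OF that] stretch_0[OF that] by (simp add: h_def)
  qed
  have h_Y: "h (s, f) = H (s, f)" if "s \<in> {0..1}" "f \<in> topspace Y" for s f
    using that push_rest[OF that(2)] by (simp add: h_def)
  show "h (s, f) \<in> topspace Y" if "s \<in> {0..1}" "f \<in> topspace Y" for s f
    using h_Y[OF that] H_in[OF that] by simp
  show "h (1, f) = a" if "f \<in> topspace Y" for f
    using h_Y[of 1 f] that H1 by simp
qed

text \<open>The end of the extended homotopy \<open>h\<close> is constant on \<open>Y\<close>, hence
  equals \<open>q \<circ> collapse\<close> for some \<open>q\<close>, and \<open>h\<close> joins it
  to the identity. As \<open>h\<close> keeps \<open>Y\<close> inside \<open>Y\<close> at all times,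
  \<open>collapse \<circ> h\<close> also descends and joins \<open>collapse \<circ> q\<close> to the
  identity of the wedge.\<close>

theorem wedge_of_spheres:
  assumes ne: "K - C \<noteq> {}" and contr: "contractible_space Y"
  shows "X homotopy_equivalent_space wedge_S3 (card C)"
proof -
  let ?W = "wedge_S3 (card C)" and ?I = "top_of_set {0..1::real}"
  obtain a where "homotopic_with (\<lambda>x. True) Y Y id (\<lambda>x. a)"
    using contr by (auto simp: contractible_space_def)
  then obtain H where H: "continuous_map (prod_topology ?I Y) Y H"
    "\<And>f. H (0, f) = f" "\<And>f. H (1, f) = a"
    by (auto simp: homotopic_with_def)
  obtain h where h: "continuous_map (prod_topology ?I X) X h"
    "\<And>f. f \<in> topspace X \<Longrightarrow> h (0, f) = f"
    "\<And>s f. s \<in> {0..1} \<Longrightarrow> f \<in> topspace Y \<Longrightarrow> h (s, f) \<in> topspace Y"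
    "\<And>f. f \<in> topspace Y \<Longrightarrow> h (1, f) = a"
    using extend_contraction[OF H] by metis
  note p = continuous_map_collapse[OF ne]
  have h1: "continuous_map X X (\<lambda>f. h (1, f))"
    using continuous_map_compose[of X "prod_topology ?I X" "\<lambda>f. (1, f)", OF _ h(1)]
    by (simp add: continuous_map_paired o_def)
  obtain q where q: "continuous_map ?W X q" "\<And>f. f \<in> topspace X \<Longrightarrow> q (collapse f) = h (1, f)"
  proof (rule quotient_map_lift_exists[OF quotient_map_collapse[OF ne] h1])
    fix f g assume "f \<in> topspace X" "g \<in> topspace X" "collapse f = collapse g"
    then show "h (1, f) = h (1, g)"
      using collapse_inj h(4) by metis
  qed metis
  obtain G where G: "continuous_map (prod_topology ?I ?W) ?W G"
    "\<And>x. x \<in> topspace (prod_topology ?I X) \<Longrightarrow> G ((\<lambda>(s, f). (s, collapse f)) x) = (collapse \<circ> h) x"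
  proof (rule quotient_map_lift_exists[OF quotient_map_collapse_cylinder[OF ne]
        continuous_map_compose[OF h(1) p]])
    fix x y assume xy: "x \<in> topspace (prod_topology ?I X)" "y \<in> topspace (prod_topology ?I X)"
      "(\<lambda>(s, f). (s, collapse f)) x = (\<lambda>(s, f). (s, collapse f)) y"
    obtain s f t g where x: "x = (s, f)" and y: "y = (t, g)"
      by (metis prod.exhaust)
    have s: "s = t" "s \<in> {0..1}" and c: "collapse f = collapse g" and X: "f \<in> topspace X" "g \<in> topspace X"
      using xy x y by auto
    consider "f = g" | "f \<in> topspace Y" "g \<in> topspace Y"
      using collapse_inj[OF X c] by blast
    then show "(collapse \<circ> h) x = (collapse \<circ> h) y"
    proof cases
      case 2
      then show ?thesis
        using collapse_rest[OF h(3)] s x y by simp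
    qed (use s x y in simp)
  qed metis
  have "homotopic_with (\<lambda>x. True) X X id (q \<circ> collapse)"
    by (subst homotopic_with, simp) (use h(1,2) q(2) in auto)
  moreover have "homotopic_with (\<lambda>x. True) ?W ?W id (collapse \<circ> q)"
  proof (subst homotopic_with, simp, intro exI[of _ G] conjI ballI)
    fix y assume "y \<in> topspace ?W"
    then obtain f where f: "f \<in> topspace X" "y = collapse f"
      using collapse_image[OF ne] by blast
    show "G (0, y) = id y"
      using G(2)[of "(0, f)"] f h(2) by simp
    show "G (1, y) = (collapse \<circ> q) y"
      using G(2)[of "(1, f)"] f q(2) by simp
  qed (use G(1) in auto)
  ultimately show ?thesis
    unfolding homotopy_equivalent_space_def
    by (intro exI[of _ collapse] exI[of _ q] conjI p q(1)) (rule homotopic_with_symD, assumption)+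
qed

end

section \<open>Collapsing along levels\<close>

text \<open>What the collapsing argument uses of the grid; only \<open>lower_clique\<close> ties
  adjacency to levels. The root being alone in level 0 makes the final remnant a single
  vertex.\<close>

locale levelled_flag_complex =
  fixes V :: "'a set" and adj :: "'a \<Rightarrow> 'a \<Rightarrow> bool" and level :: "'a \<Rightarrow> nat" and root :: 'a
  assumes finite_V: "finite V" and root: "root \<in> V"
    and level_0: "v \<in> V \<Longrightarrow> level v = 0 \<longleftrightarrow> v = root"
    and adj_refl: "v \<in> V \<Longrightarrow> adj v v"
    and adj_sym: "adj v w \<Longrightarrow> adj w v"
    and lower_clique: "\<lbrakk>v \<in> V; w \<in> V; x \<in> V; level v < level x; level w < level x; adj v x; adj w x\<rbrakk>
      \<Longrightarrow> adj v w"
begin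

definition cliques :: "'a set set" where
  "cliques = {\<sigma>. \<sigma> \<subseteq> V \<and> \<sigma> \<noteq> {} \<and> (\<forall>x\<in>\<sigma>. \<forall>y\<in>\<sigma>. adj x y)}"

definition horizontal :: "'a set \<Rightarrow> bool" where
  "horizontal \<sigma> \<longleftrightarrow> \<sigma> \<in> cliques \<and> (\<exists>l>0. \<forall>x\<in>\<sigma>. level x = l)"

definition below :: "'a set \<Rightarrow> 'a \<Rightarrow> bool" where
  "below \<sigma> v \<longleftrightarrow> v \<in> V \<and> (\<forall>x\<in>\<sigma>. level v < level x \<and> adj v x)"

definition critical :: "'a set set" where
  "critical = {\<sigma>. horizontal \<sigma> \<and> (\<forall>v. \<not> below \<sigma> v)}"

definition reducible :: "'a set set" where
  "reducible = {\<sigma>. horizontal \<sigma> \<and> (\<exists>v. below \<sigma> v)}"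

lemma finite_complex_cliques: "finite_complex V cliques"
  by unfold_locales (auto simp: cliques_def finite_V subset_iff)

lemma finite_reducible: "finite reducible"
  by (rule finite_subset[of _ "Pow V"])
     (auto simp: reducible_def horizontal_def cliques_def finite_V)

text \<open>Sorts the simplices by the star with which they are removed: when the turn of
  \<open>\<sigma>\<close> comes, the simplices still present above it all have top part
  \<open>\<sigma>\<close>.\<close>

definition top_part :: "'a set \<Rightarrow> 'a set" where
  "top_part \<tau> = {x \<in> \<tau>. \<forall>y\<in>\<tau>. level y \<le> level x}"

lemma top_part_horizontal:
  assumes "\<tau> \<in> cliques" "x \<in> \<tau>" "0 < level x"
  shows "horizontal (top_part \<tau>)"
proof -
  have "finite \<tau>"
    using assms finite_V finite_subset by (auto simp: cliques_def)
  then have "Max (level ` \<tau>) \<in> level ` \<tau>"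
    using assms(2) by (intro Max_in) auto
  then obtain z where z: "z \<in> \<tau>" "level z = Max (level ` \<tau>)"
    by (metis imageE)
  then have le: "level y \<le> level z" if "y \<in> \<tau>" for y
    using that \<open>finite \<tau>\<close> by simp
  then have "z \<in> top_part \<tau>"
    using z by (simp add: top_part_def)
  then have "top_part \<tau> \<in> cliques"
    using assms(1) by (auto simp: cliques_def top_part_def)
  moreover have "level y = level z" if "y \<in> top_part \<tau>" for y
    using that z(1) le by (force simp: top_part_def)
  moreover have "0 < level z"
    using le[OF assms(2)] assms(3) by simp
  ultimately show ?thesis
    by (auto simp: horizontal_def)
qed

context
  assumes critical_maximal: "\<sigma> \<in> critical \<Longrightarrow> \<tau> \<in> cliques \<Longrightarrow> \<sigma> \<subseteq> \<tau> \<Longrightarrow> \<tau> = \<sigma>"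
begin

text \<open>A critical top part would be a maximal clique, hence all of \<open>\<tau>\<close>, which
  is not critical.\<close>

lemma top_part_reducible:
  assumes "\<tau> \<in> cliques - critical" "x \<in> \<tau>" "0 < level x"
  shows "top_part \<tau> \<in> reducible"
proof -
  have h: "horizontal (top_part \<tau>)"
    using top_part_horizontal assms by blast
  moreover have "top_part \<tau> \<notin> critical"
    using critical_maximal[of "top_part \<tau>" \<tau>] assms(1) by (auto simp: top_part_def)
  ultimately show ?thesis
    by (auto simp: reducible_def critical_def)
qed

section \<open>Removing stars in order of rank\<close>

definition remaining :: "'a set set \<Rightarrow> 'a set set" where
  "remaining R = {\<tau> \<in> cliques - critical. \<forall>\<sigma>\<in>R. \<not> \<sigma> \<subseteq> \<tau>}"

lemma finite_complex_remaining: "finite_complex V (remaining R)"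
proof
  fix \<sigma> \<tau> assume \<sigma>: "\<sigma> \<in> remaining R" and \<tau>: "\<tau> \<subseteq> \<sigma>" "\<tau> \<noteq> {}"
  have "\<tau> \<in> cliques"
    using \<sigma> \<tau> finite_complex.face_closed[OF finite_complex_cliques] by (auto simp: remaining_def)
  moreover have "\<tau> \<notin> critical"
    using critical_maximal[of \<tau> \<sigma>] \<sigma> \<tau> by (auto simp: remaining_def)
  ultimately show "\<tau> \<in> remaining R"
    using \<sigma> \<tau> by (auto simp: remaining_def)
qed (use finite_V in \<open>auto simp: remaining_def cliques_def\<close>)

text \<open>Encodes the lexicographic order by level and then size, as \<open>Suc (card V)\<close>
  exceeds the size of every simplex. All vertices of a horizontal simplex share one level, so there
  the choice of the vertex is immaterial.\<close>

definition rank :: "'a set \<Rightarrow> nat" where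
  "rank \<sigma> = level (SOME x. x \<in> \<sigma>) * Suc (card V) + card \<sigma>"

lemma rank_less:
  assumes "horizontal \<sigma>" "horizontal \<tau>" "x \<in> \<sigma>" "y \<in> \<tau>"
    and "level x < level y \<or> \<sigma> \<subset> \<tau>"
  shows "rank \<sigma> < rank \<tau>"
proof -
  have eq: "rank \<rho> = level z * Suc (card V) + card \<rho>" if "horizontal \<rho>" "z \<in> \<rho>" for \<rho> z
  proof -
    have "(SOME x. x \<in> \<rho>) \<in> \<rho>"
      using that(2) by (rule someI)
    then show ?thesis
      using that unfolding rank_def horizontal_def by metis
  qed
  have sub: "\<sigma> \<subseteq> V" "\<tau> \<subseteq> V"
    using assms by (auto simp: horizontal_def cliques_def)
  show ?thesis
  proof (cases "\<sigma> \<subset> \<tau>")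
    case True
    then have "x \<in> \<tau>"
      using assms(3) by blast
    moreover have "card \<sigma> < card \<tau>"
      using psubset_card_mono[OF finite_subset[OF sub(2) finite_V] True] .
    ultimately show ?thesis
      using eq[OF assms(1,3)] eq[OF assms(2)] by simp
  next
    case False
    then have "Suc (level x) * Suc (card V) \<le> level y * Suc (card V)"
      using assms(5) by (intro mult_right_mono) auto
    moreover have "card \<sigma> < Suc (card V)"
      using card_mono[OF finite_V sub(1)] by simp
    ultimately show ?thesis
      using eq[OF assms(1,3)] eq[OF assms(2,4)] by simp
  qed
qed

text \<open>The top part of \<open>\<tau>\<close> contains \<open>\<sigma>\<close> or lies higher;
  if it differed from \<open>\<sigma>\<close> it would have larger rank and \<open>\<tau>\<close>
  would be gone already. So the other vertices of \<open>\<tau>\<close> are lower neighbours of any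
  vertex of \<open>\<sigma>\<close>, as is \<open>w\<close>, and \<open>lower_clique\<close> makes
  them adjacent to \<open>w\<close>. A member of \<open>R\<close> inside the cone would have to
  contain \<open>w\<close>, which gives it too small a rank.\<close>

lemma cone_step:
  assumes \<sigma>: "\<sigma> \<in> reducible" and up: "\<And>\<rho>. \<rho> \<in> reducible \<Longrightarrow> rank \<sigma> < rank \<rho> \<Longrightarrow> \<rho> \<in> R"
    and R: "R \<subseteq> reducible" "\<And>\<rho>. \<rho> \<in> R \<Longrightarrow> rank \<sigma> \<le> rank \<rho>"
    and w: "below \<sigma> w" and \<tau>: "\<tau> \<in> remaining R" "\<sigma> \<subseteq> \<tau>"
  shows "insert w \<tau> \<in> remaining R"
proof -
  have h\<sigma>: "horizontal \<sigma>"
    using \<sigma> by (simp add: reducible_def)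
  then obtain l where l: "0 < l" "\<And>y. y \<in> \<sigma> \<Longrightarrow> level y = l"
    unfolding horizontal_def by blast
  obtain x where x: "x \<in> \<sigma>"
    using h\<sigma> by (auto simp: horizontal_def cliques_def)
  have \<tau>': "\<tau> \<in> cliques - critical" and noR: "\<And>\<rho>. \<rho> \<in> R \<Longrightarrow> \<not> \<rho> \<subseteq> \<tau>"
    using \<tau>(1) by (auto simp: remaining_def)
  have "x \<in> \<tau>" using x \<tau>(2) by blast
  have red: "top_part \<tau> \<in> reducible"
    using top_part_reducible[OF \<tau>' \<open>x \<in> \<tau>\<close>] l x by simp
  then have htop: "horizontal (top_part \<tau>)"
    by (simp add: reducible_def)
  then obtain y where y: "y \<in> top_part \<tau>"
    by (auto simp: horizontal_def cliques_def)
  have "top_part \<tau> \<subseteq> \<tau>"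
    by (auto simp: top_part_def)
  then have "\<not> rank \<sigma> < rank (top_part \<tau>)"
    using up[OF red] noR by blast
  then have nl: "\<not> level x < level y" and ns: "\<not> \<sigma> \<subset> top_part \<tau>"
    using rank_less[OF h\<sigma> htop x y] by blast+
  have "level x \<le> level y"
    using y \<open>x \<in> \<tau>\<close> by (simp add: top_part_def)
  with nl have ly: "level y = l"
    using l(2)[OF x] by simp
  have le: "level z \<le> l" if "z \<in> \<tau>" for z
    using y that ly by (auto simp: top_part_def)
  have "\<sigma> \<subseteq> top_part \<tau>"
    using \<tau>(2) l(2) le by (auto simp: top_part_def)
  with ns have top: "top_part \<tau> = \<sigma>"
    by blast
  have lower: "level z < l" if "z \<in> \<tau>" "z \<notin> \<sigma>" for z
  proof (rule ccontr)
    assume "\<not> level z < l"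
    then have "level z = l"
      using le[OF that(1)] by simp
    then have "z \<in> top_part \<tau>"
      using that(1) le by (simp add: top_part_def)
    then show False
      using top that(2) by simp
  qed
  have wV: "w \<in> V" and wx: "level w < l" and wadj: "\<And>z. z \<in> \<sigma> \<Longrightarrow> adj w z"
    using w x l(2) by (auto simp: below_def)
  have "adj w z" if "z \<in> \<tau>" for z
  proof (cases "z \<in> \<sigma>")
    case False
    have "z \<in> V" "x \<in> V" "adj z x"
      using \<tau>' that \<open>x \<in> \<tau>\<close> by (auto simp: cliques_def)
    then show ?thesis
      using lower_clique[OF wV \<open>z \<in> V\<close> \<open>x \<in> V\<close>] wx lower[OF that False] l(2)[OF x] wadj[OF x] by simp
  qed (rule wadj)
  then have cl: "insert w \<tau> \<in> cliques"
    using \<tau>' wV adj_refl adj_sym by (auto simp: cliques_def)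
  have "\<not> horizontal (insert w \<tau>)"
    using wx l(2)[OF x] \<open>x \<in> \<tau>\<close> by (auto simp: horizontal_def)
  then have "insert w \<tau> \<notin> critical"
    by (simp add: critical_def)
  moreover have "\<not> \<rho> \<subseteq> insert w \<tau>" if "\<rho> \<in> R" for \<rho>
  proof
    assume sub: "\<rho> \<subseteq> insert w \<tau>"
    have h\<rho>: "horizontal \<rho>"
      using that R(1) by (auto simp: reducible_def)
    have "w \<notin> \<rho>"
    proof
      assume "w \<in> \<rho>"
      then have "rank \<rho> < rank \<sigma>"
        using rank_less[OF h\<rho> h\<sigma> _ x] wx l(2)[OF x] by blast
      then show False
        using R(2)[OF that] by simp
    qed
    then show False
      using sub noR[OF that] by blast
  qed
  ultimately show ?thesis
    using cl by (simp add: remaining_def)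
qed

text \<open>The induction splits off an element of least rank, whose star is the last to go; the
  rest of \<open>R\<close> is still closed under passing to larger rank.\<close>

lemma homotopy_equivalent_remaining:
  assumes "finite R" "R \<subseteq> reducible"
    and "\<And>\<sigma> \<rho>. \<sigma> \<in> R \<Longrightarrow> \<rho> \<in> reducible \<Longrightarrow> rank \<sigma> < rank \<rho> \<Longrightarrow> \<rho> \<in> R"
  shows "geom_realization V (cliques - critical) homotopy_equivalent_space geom_realization V (remaining R)"
  using assms
proof (induction "card R" arbitrary: R)
  case 0
  then have "remaining R = cliques - critical"
    by (auto simp: remaining_def)
  then show ?case
    by (simp add: homotopy_equivalent_space_refl)
next
  case (Suc n)
  then have "R \<noteq> {}" by auto
  then obtain \<sigma> where \<sigma>: "\<sigma> \<in> R" and min: "\<And>\<rho>. \<rho> \<in> R \<Longrightarrow> rank \<sigma> \<le> rank \<rho>"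
    using ex_min_if_finite[of "rank ` R"] Suc.prems(1)
    by (metis (no_types, lifting) finite_imageI image_iff image_is_empty linorder_not_less)
  let ?R = "R - {\<sigma>}"
  have red: "\<sigma> \<in> reducible"
    using \<sigma> Suc.prems(2) by blast
  then obtain w where w: "below \<sigma> w"
    by (auto simp: reducible_def)
  have IH: "geom_realization V (cliques - critical) homotopy_equivalent_space geom_realization V (remaining ?R)"
  proof (rule Suc.hyps(1))
    show "n = card ?R"
      using Suc.hyps(2) \<sigma> Suc.prems(1) by simp
    show "\<rho> \<in> ?R" if "\<sigma>' \<in> ?R" "\<rho> \<in> reducible" "rank \<sigma>' < rank \<rho>" for \<sigma>' \<rho>
      using Suc.prems(3)[of \<sigma>' \<rho>] min[of \<sigma>'] that by auto
  qed (use Suc.prems in auto)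
  have "{\<tau> \<in> remaining ?R. \<not> \<sigma> \<subseteq> \<tau>} = remaining R"
    using \<sigma> by (auto simp: remaining_def)
  moreover have "geom_realization V (remaining ?R) homotopy_equivalent_space
      geom_realization V {\<tau> \<in> remaining ?R. \<not> \<sigma> \<subseteq> \<tau>}"
  proof (rule finite_complex.collapse_star[OF finite_complex_remaining])
    show "w \<in> V" "w \<notin> \<sigma>"
      using w by (auto simp: below_def)
    show "\<sigma> \<noteq> {}" "\<sigma> \<subseteq> V"
      using red by (auto simp: reducible_def horizontal_def cliques_def)
    show "insert w \<tau> \<in> remaining ?R" if "\<tau> \<in> remaining ?R" "\<sigma> \<subseteq> \<tau>" for \<tau>
    proof (rule cone_step[OF red _ _ _ w that])
      show "\<rho> \<in> ?R" if "\<rho> \<in> reducible" "rank \<sigma> < rank \<rho>" for \<rho>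
        using Suc.prems(3)[OF \<sigma> that] that(2) by auto
    qed (use Suc.prems(2) min in auto)
  qed
  ultimately show ?case
    using IH homotopy_eqv_trans by metis
qed

lemma remaining_reducible: "remaining reducible = {{root}}"
proof (intro equalityI subsetI)
  fix \<tau> assume \<tau>: "\<tau> \<in> remaining reducible"
  have "level x = 0" if "x \<in> \<tau>" for x
  proof (rule ccontr)
    assume "level x \<noteq> 0"
    then have "top_part \<tau> \<in> reducible"
      using top_part_reducible[of \<tau> x] that \<tau> by (auto simp: remaining_def)
    then show False
      using \<tau> by (auto simp: remaining_def top_part_def)
  qed
  then have "x = root" if "x \<in> \<tau>" for x
    using level_0[of x] that \<tau> by (auto simp: remaining_def cliques_def)
  moreover have "\<tau> \<noteq> {}"
    using \<tau> by (auto simp: remaining_def cliques_def)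
  ultimately show "\<tau> \<in> {{root}}"
    by blast
next
  fix \<tau> assume "\<tau> \<in> {{root}}"
  then have \<tau>: "\<tau> = {root}" by simp
  have "level root = 0"
    using level_0 root by blast
  then have h: "\<not> horizontal \<rho>" if "\<rho> \<subseteq> {root}" for \<rho>
    using that by (auto simp: horizontal_def cliques_def)
  have "\<tau> \<in> cliques"
    using root adj_refl by (simp add: cliques_def \<tau>)
  then show "\<tau> \<in> remaining reducible"
    using h \<tau> by (auto simp: remaining_def critical_def reducible_def)
qed

lemma contractible_noncritical: "contractible_space (geom_realization V (cliques - critical))"
proof -
  have "geom_realization V (cliques - critical) homotopy_equivalent_space geom_realization V {{root}}"
    using homotopy_equivalent_remaining[OF finite_reducible] by (simp add: remaining_reducible)
  then show ?thesis
    using contractible_realization_vertex[OF finite_V root] homotopy_equivalent_space_contractibility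
    by blast
qed

theorem wedge_of_critical:
  assumes card: "\<And>\<sigma>. \<sigma> \<in> critical \<Longrightarrow> card \<sigma> = 4"
  shows "geom_realization V cliques homotopy_equivalent_space wedge_S3 (card critical)"
proof -
  have fin: "finite critical"
    by (rule finite_subset[of _ "Pow V"])
       (auto simp: critical_def horizontal_def cliques_def finite_V)
  obtain num where num: "bij_betw num critical {1..card critical}"
    using finite_same_card_bij[OF fin, of "{1..card critical}"] by auto
  have "\<exists>b :: 4 \<Rightarrow> 'a. bij_betw b UNIV \<sigma>" if "\<sigma> \<in> critical" for \<sigma>
    using card[OF that] by (intro finite_same_card_bij) (auto intro: card_ge_0_finite)
  then obtain b :: "'a set \<Rightarrow> 4 \<Rightarrow> 'a" where b: "\<And>\<sigma>. \<sigma> \<in> critical \<Longrightarrow> bij_betw (b \<sigma>) UNIV \<sigma>"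
    by metis
  interpret finite_complex V cliques
    by (rule finite_complex_cliques)
  interpret tetrahedral_facets V cliques critical num b
    using num b critical_maximal by unfold_locales (auto simp: critical_def horizontal_def)
  have "{root} \<in> remaining reducible"
    by (simp add: remaining_reducible)
  then have "cliques - critical \<noteq> {}"
    by (auto simp: remaining_def)
  then show ?thesis
    using contractible_noncritical by (rule wedge_of_spheres)
qed

end

end

section \<open>Geometry of the grid\<close>

lemma grid_iff: "x \<in> grid n m \<longleftrightarrow> x \<in> extensional {..<n} \<and> (\<forall>i<n. 0 \<le> x i \<and> x i \<le> int m)"
  by (auto simp: grid_def PiE_iff)

lemma grid_eqI: "x \<in> grid n m \<Longrightarrow> y \<in> grid n m \<Longrightarrow> (\<And>i. i < n \<Longrightarrow> x i = y i) \<Longrightarrow> x = y"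
  unfolding grid_iff by (intro extensionalityI[of x "{..<n}" y]) auto

lemma finite_grid: "finite (grid n m)"
  unfolding grid_def by (intro finite_PiE) auto

lemma manhattan_nonneg: "0 \<le> manhattan n x y"
  unfolding manhattan_def by (intro sum_nonneg) simp

lemma manhattan_self [simp]: "manhattan n x x = 0"
  by (simp add: manhattan_def)

lemma manhattan_sym: "manhattan n x y = manhattan n y x"
  by (simp add: manhattan_def abs_minus_commute)

lemma manhattan_triangle: "manhattan n x z \<le> manhattan n x y + manhattan n y z"
  unfolding manhattan_def sum.distrib[symmetric] by (intro sum_mono) simp

lemma manhattan_eq_0:
  assumes "x \<in> grid n m" "y \<in> grid n m"
  shows "manhattan n x y = 0 \<longleftrightarrow> x = y"
proof
  assume "manhattan n x y = 0"
  then have "\<forall>i\<in>{..<n}. \<bar>x i - y i\<bar> = 0"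
    unfolding manhattan_def by (subst (asm) sum_nonneg_eq_0_iff) auto
  then show "x = y"
    using assms by (intro grid_eqI) auto
qed simp

lemma manhattan_remove:
  "k < n \<Longrightarrow> manhattan n x y = \<bar>x k - y k\<bar> + (\<Sum>i\<in>{..<n} - {k}. \<bar>x i - y i\<bar>)"
  unfolding manhattan_def by (rule sum.remove) auto

lemma manhattan_step_cases:
  assumes "manhattan n p q = 1"
  obtains k where "k < n" "\<bar>p k - q k\<bar> = 1" "\<And>i. i < n \<Longrightarrow> i \<noteq> k \<Longrightarrow> p i = q i"
proof -
  have "\<exists>k\<in>{..<n}. \<bar>p k - q k\<bar> \<noteq> 0"
  proof (rule ccontr)
    assume "\<not> (\<exists>k\<in>{..<n}. \<bar>p k - q k\<bar> \<noteq> 0)"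
    then have "manhattan n p q = 0"
      unfolding manhattan_def by (intro sum.neutral) blast
    then show False
      using assms by simp
  qed
  then obtain k where k: "k < n" "1 \<le> \<bar>p k - q k\<bar>"
    by (auto simp: abs_if split: if_splits)
  have nonneg: "0 \<le> (\<Sum>i\<in>{..<n} - {k}. \<bar>p i - q i\<bar>)"
    by (intro sum_nonneg) simp
  then have 0: "(\<Sum>i\<in>{..<n} - {k}. \<bar>p i - q i\<bar>) = 0" and 1: "\<bar>p k - q k\<bar> = 1"
    using manhattan_remove[OF k(1), of p q] assms k(2) by linarith+
  have "\<forall>i\<in>{..<n} - {k}. \<bar>p i - q i\<bar> = 0"
    using 0 by (subst (asm) sum_nonneg_eq_0_iff) auto
  then show thesis
    using that[OF k(1) 1] by auto
qed

lemma manhattan_change: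
  assumes "k < n" "\<And>i. i < n \<Longrightarrow> i \<noteq> k \<Longrightarrow> p i = q i"
  shows "manhattan n z p - \<bar>z k - p k\<bar> = manhattan n z q - \<bar>z k - q k\<bar>"
proof -
  have "(\<Sum>i\<in>{..<n} - {k}. \<bar>z i - p i\<bar>) = (\<Sum>i\<in>{..<n} - {k}. \<bar>z i - q i\<bar>)"
    using assms(2) by (intro sum.cong) auto
  then show ?thesis
    using manhattan_remove[OF assms(1), of z] by simp
qed

lemma manhattan_step:
  assumes "manhattan n q p = 1"
  shows "manhattan n z p = manhattan n z q + 1 \<or> manhattan n z p = manhattan n z q - 1"
proof -
  obtain k where k: "k < n" "\<bar>q k - p k\<bar> = 1" "\<And>i. i < n \<Longrightarrow> i \<noteq> k \<Longrightarrow> q i = p i"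
    using manhattan_step_cases[OF assms] by blast
  then show ?thesis
    using manhattan_change[OF k(1), of p q z] by (auto simp: abs_if split: if_splits)
qed

text \<open>A neighbour of \<open>q\<close> nearer to \<open>z\<close> is determined by the
  coordinate in which it moves. There \<open>z\<close> and \<open>q\<close> differ, and each such
  coordinate contributes at least 1 to the distance.\<close>

lemma card_steps_towards:
  assumes q: "q \<in> grid n m" and P: "P \<subseteq> grid n m"
    and steps: "\<And>p. p \<in> P \<Longrightarrow> manhattan n q p = 1 \<and> manhattan n z p < manhattan n z q"
  shows "int (card P) \<le> manhattan n z q"
proof -
  define D where "D = {k. k < n \<and> z k \<noteq> q k}"
  define F where "F k = q(k := q k + sgn (z k - q k))" for k
  have fin: "finite D"
    by (simp add: D_def)
  have "P \<subseteq> F ` D"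
  proof
    fix p assume p: "p \<in> P"
    obtain k where k: "k < n" "\<bar>q k - p k\<bar> = 1" "\<And>i. i < n \<Longrightarrow> i \<noteq> k \<Longrightarrow> q i = p i"
      using steps[OF p] manhattan_step_cases by metis
    have less: "\<bar>z k - p k\<bar> < \<bar>z k - q k\<bar>"
      using manhattan_change[OF k(1), of p q z] k(3) steps[OF p] by fastforce
    then have "k \<in> D"
      using k(1) by (auto simp: D_def)
    have pk: "p k = q k + sgn (z k - q k)"
      using less k(2) by (auto simp: sgn_if abs_if split: if_splits)
    have "p = F k"
    proof
      fix i
      show "p i = F k i"
      proof (cases "i < n")
        case True
        then show ?thesis
          using pk k(3) by (simp add: F_def)
      next
        case False
        then show ?thesis
          using p P q k(1) by (auto simp: F_def grid_iff extensional_def)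
      qed
    qed
    then show "p \<in> F ` D"
      using \<open>k \<in> D\<close> by blast
  qed
  then have "card P \<le> card D"
    using fin by (meson card_image_le card_mono finite_imageI order_trans)
  also have "int (card D) = (\<Sum>k\<in>D. 1)"
    by simp
  also have "\<dots> \<le> (\<Sum>k\<in>D. \<bar>z k - q k\<bar>)"
    by (intro sum_mono) (auto simp: D_def)
  also have "\<dots> \<le> manhattan n z q"
    unfolding manhattan_def by (intro sum_mono2) (auto simp: D_def)
  finally show ?thesis by simp
qed

section \<open>Medians and centers of cliques\<close>

definition med :: "int \<Rightarrow> int \<Rightarrow> int \<Rightarrow> int" where
  "med a b c = max (min a b) (min (max a b) c)"

lemma med_between:
  "\<bar>a - med a b c\<bar> + \<bar>b - med a b c\<bar> = \<bar>a - b\<bar>"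
  "\<bar>a - med a b c\<bar> + \<bar>c - med a b c\<bar> = \<bar>a - c\<bar>"
  "\<bar>b - med a b c\<bar> + \<bar>c - med a b c\<bar> = \<bar>b - c\<bar>"
  by (auto simp: med_def min_def max_def)

lemma med_range:
  "l \<le> a \<Longrightarrow> l \<le> b \<Longrightarrow> l \<le> med a b c"
  "a \<le> h \<Longrightarrow> b \<le> h \<Longrightarrow> med a b c \<le> h"
  by (auto simp: med_def)

text \<open>Taken coordinatewise, the median lies on a shortest path between any two of the three
  points.\<close>

lemma median:
  assumes "x \<in> grid n m" "y \<in> grid n m" "z \<in> grid n m"
  obtains \<mu> where "\<mu> \<in> grid n m"
    "manhattan n x \<mu> + manhattan n y \<mu> = manhattan n x y"
    "manhattan n x \<mu> + manhattan n z \<mu> = manhattan n x z"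
    "manhattan n y \<mu> + manhattan n z \<mu> = manhattan n y z"
proof -
  define \<mu> where "\<mu> = restrict (\<lambda>i. med (x i) (y i) (z i)) {..<n}"
  have \<mu>: "\<mu> i = med (x i) (y i) (z i)" if "i < n" for i
    using that by (simp add: \<mu>_def)
  show thesis
  proof
    show "\<mu> \<in> grid n m"
      using assms by (auto simp: grid_iff \<mu>_def med_range)
  qed (unfold manhattan_def sum.distrib[symmetric], auto intro!: sum.cong simp: \<mu> med_between)
qed

lemma midpoint:
  assumes x: "x \<in> grid n m" and y: "y \<in> grid n m" and d: "manhattan n x y \<le> 2"
  obtains q where "q \<in> grid n m" "manhattan n q x \<le> 1" "manhattan n q y \<le> 1"
proof (cases "x = y")
  case True
  then show thesis
    using that[of x] x by simp
next
  case False
  then obtain k where k: "k < n" "x k \<noteq> y k"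
    using grid_eqI[OF x y] by blast
  define q where "q = x(k := x k + sgn (y k - x k))"
  have "q \<in> grid n m"
    unfolding grid_iff
  proof (intro conjI allI impI)
    show "q \<in> extensional {..<n}"
      using x k(1) by (auto simp: q_def grid_iff extensional_def)
    have "0 \<le> x k" "x k \<le> int m" "0 \<le> y k" "y k \<le> int m"
      using x y k(1) by (auto simp: grid_iff)
    then show "0 \<le> q i" "q i \<le> int m" if "i < n" for i
      using x that k(2) by (auto simp: q_def grid_iff sgn_if)
  qed
  moreover have "manhattan n x q = 1"
    using manhattan_change[OF k(1), of q x x] k(2) by (simp add: q_def abs_sgn_eq)
  moreover have "manhattan n y q \<le> 1"
    using manhattan_change[OF k(1), of q x y] k(2) d manhattan_sym[of n x y]
    by (simp add: q_def sgn_if abs_if split: if_splits)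
  ultimately show thesis
    using that[of q] by (simp add: manhattan_sym)
qed

text \<open>Up to three points, a vertex, a midpoint or the median serves. For five or more points
  without a center, take \<open>a\<close> and \<open>b\<close> at distance 2: they have at most two
  common neighbours, and each further point is within 1 of one of these, so two further points share
  some \<open>q\<close>. Then \<open>q\<close> has too many neighbours in \<open>A\<close> for a
  point \<open>z\<close> at distance at least 2 from it.\<close>

lemma clique_center:
  assumes A: "A \<subseteq> grid n m" "A \<noteq> {}" and clique: "\<And>x y. x \<in> A \<Longrightarrow> y \<in> A \<Longrightarrow> manhattan n x y \<le> 2"
    and card: "card A \<noteq> 4"
  shows "\<exists>q\<in>grid n m. \<forall>a\<in>A. manhattan n q a \<le> 1"
proof -
  have fin: "finite A"
    using A(1) finite_grid finite_subset by blast
  have pos: "1 \<le> manhattan n x y" if "x \<in> A" "y \<in> A" "x \<noteq> y" for x y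
    using that A(1) manhattan_eq_0[of x n m y] manhattan_nonneg[of n x y] by force
  \<comment> \<open>If one distance to the median were 2, the other two would be 0 and two of the
    points would coincide.\<close>
  have med3: "\<exists>\<mu>\<in>grid n m. manhattan n a \<mu> \<le> 1 \<and> manhattan n b \<mu> \<le> 1 \<and> manhattan n c \<mu> \<le> 1 \<and>
      manhattan n a \<mu> + manhattan n b \<mu> = manhattan n a b"
    if abc: "a \<in> A" "b \<in> A" "c \<in> A" "a \<noteq> b" "a \<noteq> c" "b \<noteq> c" for a b c
  proof -
    obtain \<mu> where \<mu>: "\<mu> \<in> grid n m"
      "manhattan n a \<mu> + manhattan n b \<mu> = manhattan n a b"
      "manhattan n a \<mu> + manhattan n c \<mu> = manhattan n a c"
      "manhattan n b \<mu> + manhattan n c \<mu> = manhattan n b c"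
      using median[of a n m b c] abc A(1) by blast
    then show ?thesis
      using clique[of a b] clique[of a c] clique[of b c] pos[of a b] pos[of a c] pos[of b c] abc
        manhattan_nonneg[of n a \<mu>] manhattan_nonneg[of n b \<mu>] manhattan_nonneg[of n c \<mu>]
      by (intro bexI[of _ \<mu>]) auto
  qed
  have "0 < card A"
    using A(2) fin by (simp add: card_gt_0_iff)
  then consider "card A = 1" | "card A = 2" | "card A = 3" | "5 \<le> card A"
    using card by linarith
  then show ?thesis
  proof cases
    case 1
    then obtain a where "A = {a}"
      by (auto simp: card_1_singleton_iff)
    then show ?thesis
      using A(1) by (intro bexI[of _ a]) auto
  next
    case 2
    then obtain a b where "A = {a, b}"
      by (auto simp: card_2_iff)
    moreover obtain q where "q \<in> grid n m" "manhattan n q a \<le> 1" "manhattan n q b \<le> 1"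
      using midpoint[of a n m b] A(1) clique[of a b] calculation by blast
    ultimately show ?thesis
      by (intro bexI[of _ q]) auto
  next
    case 3
    then obtain a b c where abc: "A = {a, b, c}" "a \<noteq> b" "a \<noteq> c" "b \<noteq> c"
      by (auto simp: card_3_iff)
    then obtain \<mu> where "\<mu> \<in> grid n m" "manhattan n a \<mu> \<le> 1" "manhattan n b \<mu> \<le> 1" "manhattan n c \<mu> \<le> 1"
      using med3[of a b c] by auto
    then show ?thesis
      using abc(1) by (intro bexI[of _ \<mu>]) (auto simp: manhattan_sym[of n \<mu>])
  next
    case 4
    show ?thesis
    proof (rule ccontr)
      assume "\<not> ?thesis"
      then have none: "\<exists>a\<in>A. 2 \<le> manhattan n q a" if "q \<in> grid n m" for q
        using that by force
      obtain a where a: "a \<in> A" using A(2) by blast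
      then obtain b where b: "b \<in> A" "2 \<le> manhattan n a b"
        using none[of a] A(1) by blast
      then have ab: "manhattan n a b = 2" "a \<noteq> b"
        using clique[OF a b(1)] by auto
      define M where "M = {p \<in> grid n m. manhattan n a p = 1 \<and> manhattan n b p = 1}"
      have "int (card M) \<le> manhattan n b a"
        using a A(1) ab(1) by (intro card_steps_towards[of a n m]) (auto simp: M_def manhattan_sym)
      then have cardM: "card M \<le> 2"
        using ab(1) by (simp add: manhattan_sym)
      have "\<exists>\<mu>\<in>M. manhattan n c \<mu> \<le> 1" if c: "c \<in> A - {a, b}" for c
      proof -
        obtain \<mu> where "\<mu> \<in> grid n m" "manhattan n a \<mu> \<le> 1" "manhattan n b \<mu> \<le> 1" "manhattan n c \<mu> \<le> 1"
          "manhattan n a \<mu> + manhattan n b \<mu> = manhattan n a b"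
          using med3[of a b c] a b(1) c ab(2) by blast
        then show ?thesis
          using ab(1) by (intro bexI[of _ \<mu>]) (auto simp: M_def)
      qed
      then obtain f where f: "\<And>c. c \<in> A - {a, b} \<Longrightarrow> f c \<in> M \<and> manhattan n c (f c) \<le> 1"
        by metis
      have "card (A - {a, b}) = card A - 2"
        using a b(1) ab(2) fin by (subst card_Diff_subset) auto
      then have "card M < card (A - {a, b})"
        using 4 cardM by linarith
      moreover have "finite M"
        using finite_grid[of n m] by (auto simp: M_def)
      ultimately have "\<not> inj_on f (A - {a, b})"
        using f by (metis card_inj_on_le image_subsetI linorder_not_less)
      then obtain c c' where c: "c \<in> A - {a, b}" "c' \<in> A - {a, b}" "c \<noteq> c'" "f c = f c'"
        by (auto simp: inj_on_def)
      define q where "q = f c"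
      have q: "q \<in> grid n m" and qa: "manhattan n q a = 1" "manhattan n q b = 1"
        using f[OF c(1)] by (auto simp: q_def M_def manhattan_sym)
      have qc: "manhattan n q c \<le> 1" "manhattan n q c' \<le> 1"
        using f[OF c(1)] f[OF c(2)] c(4) by (auto simp: q_def manhattan_sym)
      obtain z where z: "z \<in> A" "2 \<le> manhattan n z q"
        using none[OF q] by (auto simp: manhattan_sym)
      define P where "P = {a, b, c, c'} - {q}"
      have PA: "P \<subseteq> A"
        using a b(1) c by (auto simp: P_def)
      have q1: "manhattan n q p = 1" if "p \<in> P" for p
      proof -
        have "manhattan n q p \<le> 1"
          using that qa qc by (auto simp: P_def)
        moreover have "manhattan n q p \<noteq> 0"
          using manhattan_eq_0[OF q, of p] that PA A(1) by (auto simp: P_def)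
        ultimately show ?thesis
          using manhattan_nonneg[of n q p] by linarith
      qed
      \<comment> \<open>A unit step changes the distance to \<open>z\<close> by exactly 1, and an
        increase would give at least 3 inside the clique.\<close>
      have "manhattan n z p < manhattan n z q" if "p \<in> P" for p
        using manhattan_step[OF q1[OF that], of z] clique[OF z(1), of p] that PA z(2) by auto
      then have le: "int (card P) \<le> manhattan n z q"
        using q1 PA A(1) by (intro card_steps_towards[OF q]) auto
      have "manhattan n z q \<le> 3"
        using manhattan_triangle[of n z q a] clique[OF z(1) a] qa(1) by (simp add: manhattan_sym)
      have c4: "card {a, b, c, c'} = 4"
        using c ab(2) by auto
      \<comment> \<open>If \<open>q\<close> is one of the four points, three neighbours face a
        distance of at most 2; otherwise four face a distance of at most 3.\<close>
      show False
      proof (cases "q \<in> {a, b, c, c'}")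
        case True
        then have "manhattan n z q \<le> 2"
          using clique[OF z(1), of q] a b(1) c by auto
        moreover have "card P = 3"
          using True c4 by (simp add: P_def)
        ultimately show False
          using le by simp
      next
        case False
        then have "card P = 4"
          using c4 by (simp add: P_def)
        then show False
          using le \<open>manhattan n z q \<le> 3\<close> by simp
      qed
    qed
  qed
qed

section \<open>Levels of grid points\<close>

text \<open>\<open>last_nonzero n x k\<close>: the last nonzero coordinate of \<open>x\<close> has index \<open>k\<close>. The level of \<open>x\<close> orders the grid
  lexicographically by \<open>k\<close> and \<open>x k\<close>; as \<open>1 \<le> x k \<le> m\<close>, distinct pairs have distinct levels.\<close>

definition last_nonzero :: "nat \<Rightarrow> (nat \<Rightarrow> int) \<Rightarrow> nat \<Rightarrow> bool" where
  "last_nonzero n x k \<longleftrightarrow> k < n \<and> 0 < x k \<and> (\<forall>i<n. k < i \<longrightarrow> x i = 0)"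

definition level :: "nat \<Rightarrow> nat \<Rightarrow> (nat \<Rightarrow> int) \<Rightarrow> nat" where
  "level n m x = (if \<exists>k. last_nonzero n x k then let k = (THE k. last_nonzero n x k) in k * m + nat (x k) else 0)"

lemma last_nonzero_unique: "last_nonzero n x k \<Longrightarrow> last_nonzero n x l \<Longrightarrow> k = l"
  unfolding last_nonzero_def by (metis less_irrefl linorder_neqE_nat)

lemma level_top:
  assumes "last_nonzero n x k"
  shows "level n m x = k * m + nat (x k)"
proof -
  have "(THE k. last_nonzero n x k) = k"
    using assms by (rule the_equality) (rule last_nonzero_unique[OF _ assms])
  then show ?thesis
    using assms unfolding level_def Let_def by (subst if_P) auto
qed

lemma last_nonzero_exists:
  assumes "x \<in> grid n m" "i < n" "x i \<noteq> 0"
  shows "\<exists>k. last_nonzero n x k"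
proof -
  let ?S = "{i. i < n \<and> x i \<noteq> 0}"
  have fin: "finite ?S" and "?S \<noteq> {}"
    using assms by auto
  then have k: "Max ?S \<in> ?S"
    by (rule Max_in)
  have "x i = 0" if "i < n" "Max ?S < i" for i
    using Max_ge[OF fin, of i] that by fastforce
  moreover have "0 < x (Max ?S)"
  proof -
    have "0 \<le> x (Max ?S)" "x (Max ?S) \<noteq> 0"
      using k assms(1) by (simp_all add: grid_iff)
    then show ?thesis by simp
  qed
  ultimately have "last_nonzero n x (Max ?S)"
    using k unfolding last_nonzero_def by blast
  then show ?thesis by blast
qed

lemma level_eq_0_iff:
  assumes "x \<in> grid n m"
  shows "level n m x = 0 \<longleftrightarrow> x = restrict (\<lambda>_. 0) {..<n}"
proof (cases "\<exists>k. last_nonzero n x k")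
  case True
  then obtain k where "last_nonzero n x k" ..
  then show ?thesis
    using level_top[of n x k m] by (auto simp: last_nonzero_def)
next
  case False
  then have "x i = 0" if "i < n" for i
    using last_nonzero_exists[OF assms that] by blast
  then have "x = restrict (\<lambda>_. 0) {..<n}"
    using assms by (auto simp: grid_iff extensional_def fun_eq_iff)
  then show ?thesis
    using False by (simp add: level_def)
qed

lemma last_nonzero_range: "x \<in> grid n m \<Longrightarrow> last_nonzero n x k \<Longrightarrow> 1 \<le> nat (x k) \<and> nat (x k) \<le> m"
  by (auto simp: last_nonzero_def grid_iff)

lemma level_less_iff:
  assumes x: "x \<in> grid n m" "last_nonzero n x k" and y: "y \<in> grid n m" "last_nonzero n y l"
  shows "level n m x < level n m y \<longleftrightarrow> k < l \<or> k = l \<and> x k < y l"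
proof -
  have *: "i * m + a < j * m + b" if "i < j" "a \<le> m" "1 \<le> b" for i j a b
  proof -
    have "Suc i * m \<le> j * m"
      using that(1) by (intro mult_right_mono) auto
    then show ?thesis
      using that by simp
  qed
  note rx = last_nonzero_range[OF x] and ry = last_nonzero_range[OF y]
  consider "k < l" | "k = l" | "l < k" by linarith
  then show ?thesis
  proof cases
    case 1
    then show ?thesis
      using *[of k l] rx ry level_top[OF x(2)] level_top[OF y(2)] by simp
  next
    case 2
    then show ?thesis
      using rx ry level_top[OF x(2)] level_top[OF y(2)] by auto
  next
    case 3
    then show ?thesis
      using *[of l k "nat (y l)" "nat (x k)"] rx ry level_top[OF x(2)] level_top[OF y(2)] by simp
  qed
qed

text \<open>Only the last nonzero coordinate of \<open>x\<close> is mentioned, so the origin is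
  covered as a possible \<open>v\<close>.\<close>

lemma level_less_top:
  assumes v: "v \<in> grid n m" and x: "x \<in> grid n m" "last_nonzero n x k"
  shows "level n m v < level n m x \<longleftrightarrow> (\<forall>i<n. k < i \<longrightarrow> v i = 0) \<and> v k < x k"
proof (cases "\<exists>l. last_nonzero n v l")
  case True
  then obtain l where l: "last_nonzero n v l" ..
  have "k < n" "0 < x k"
    using x(2) by (auto simp: last_nonzero_def)
  have vk: "0 \<le> v k"
    using v \<open>k < n\<close> by (simp add: grid_iff)
  show ?thesis
    unfolding level_less_iff[OF v l x]
  proof
    assume "l < k \<or> l = k \<and> v l < x k"
    then show "(\<forall>i<n. k < i \<longrightarrow> v i = 0) \<and> v k < x k"
      using l \<open>k < n\<close> \<open>0 < x k\<close> by (auto simp: last_nonzero_def)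
  next
    assume *: "(\<forall>i<n. k < i \<longrightarrow> v i = 0) \<and> v k < x k"
    then have "\<not> k < l"
      using l by (auto simp: last_nonzero_def)
    then show "l < k \<or> l = k \<and> v l < x k"
      using * by (cases "l = k") auto
  qed
next
  case False
  then have "v i = 0" if "i < n" for i
    using last_nonzero_exists[OF v that] by blast
  moreover have "level n m v = 0"
    using False by (simp add: level_def)
  ultimately show ?thesis
    using x(2) level_top[OF x(2), of m] by (auto simp: last_nonzero_def)
qed

lemma level_pos_top:
  assumes "0 < level n m x"
  obtains k where "last_nonzero n x k"
proof (cases "\<exists>k. last_nonzero n x k")
  case False
  then show ?thesis
    using assms by (simp add: level_def)
qed (use that in blast)

text \<open>Let p and q be the positive drops from \<open>x\<close> to \<open>v\<close> and
  \<open>w\<close> in coordinate \<open>k\<close>. The other coordinates contribute at most (2 - p)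
  + (2 - q) and \<open>k\<close> itself |p - q|; in total at most 4 - 2 min(p, q) \<le> 2.\<close>

lemma lower_close:
  assumes "k < n" "v k < x k" "w k < x k" "manhattan n v x \<le> 2" "manhattan n w x \<le> 2"
  shows "manhattan n v w \<le> 2"
proof -
  have "(\<Sum>i\<in>{..<n} - {k}. \<bar>v i - w i\<bar>) \<le> (\<Sum>i\<in>{..<n} - {k}. \<bar>v i - x i\<bar>) + (\<Sum>i\<in>{..<n} - {k}. \<bar>w i - x i\<bar>)"
    unfolding sum.distrib[symmetric] by (intro sum_mono) simp
  then show ?thesis
    using assms manhattan_remove[OF assms(1), of v w] manhattan_remove[OF assms(1), of v x]
      manhattan_remove[OF assms(1), of w x] by linarith
qed

section \<open>Critical simplices of the grid\<close>

locale grid_levels =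
  fixes n m :: nat
begin

sublocale levelled_flag_complex "grid n m" "\<lambda>x y. manhattan n x y \<le> 2" "level n m" "restrict (\<lambda>_. 0) {..<n}"
proof
  show "restrict (\<lambda>_. 0) {..<n} \<in> grid n m"
    by (simp add: grid_iff)
  show "level n m v = 0 \<longleftrightarrow> v = restrict (\<lambda>_. 0) {..<n}" if "v \<in> grid n m" for v
    using that by (rule level_eq_0_iff)
  show "manhattan n w v \<le> 2" if "manhattan n v w \<le> 2" for v w
    using that by (simp add: manhattan_sym)
  fix v w x
  assume "v \<in> grid n m" "w \<in> grid n m" "x \<in> grid n m" "level n m v < level n m x"
    "level n m w < level n m x" "manhattan n v x \<le> 2" "manhattan n w x \<le> 2"
  moreover from this obtain k where "last_nonzero n x k"
    using level_pos_top[of n m x] by auto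
  ultimately show "manhattan n v w \<le> 2"
    using level_less_top[of v n m x k] level_less_top[of w n m x k] lower_close[of k n v x w]
    by (auto simp: last_nonzero_def)
qed (auto simp: finite_grid)

lemma cliques_eq_VR: "cliques = VR (grid n m) (manhattan n) 2"
  unfolding cliques_def VR_def using finite_subset[OF _ finite_grid] by blast

text \<open>A center of a horizontal simplex, moved one step down, is a common lower neighbour.\<close>

lemma critical_no_center:
  assumes \<sigma>: "\<sigma> \<in> critical" and q: "q \<in> grid n m"
  shows "\<exists>a\<in>\<sigma>. 1 < manhattan n q a"
proof (rule ccontr)
  assume "\<not> ?thesis"
  then have center: "manhattan n q a \<le> 1" if "a \<in> \<sigma>" for a
    using that by force
  have hor: "horizontal \<sigma>"
    using \<sigma> by (simp add: critical_def)
  then have sub: "\<sigma> \<subseteq> grid n m"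
    by (simp add: horizontal_def cliques_def)
  obtain l where l: "0 < l" "\<And>x. x \<in> \<sigma> \<Longrightarrow> level n m x = l"
    using hor unfolding horizontal_def by blast
  obtain x where x: "x \<in> \<sigma>"
    using hor by (auto simp: horizontal_def cliques_def)
  obtain k where k: "last_nonzero n x k"
    using level_pos_top[of n m x] l x by auto
  then have kn: "k < n" and xk: "0 < x k"
    by (auto simp: last_nonzero_def)
  \<comment> \<open>Equal levels mean equal position and equal value of the last nonzero
    coordinate.\<close>
  have top: "last_nonzero n y k \<and> y k = x k" if y: "y \<in> \<sigma>" for y
  proof -
    obtain j where j: "last_nonzero n y j"
      using level_pos_top[of n m y] l y by auto
    have "\<not> level n m x < level n m y" "\<not> level n m y < level n m x"
      using l(2) x y by auto
    then show ?thesis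
      using level_less_iff[of x n m k y j] level_less_iff[of y n m j x k] sub x y k j by fastforce
  qed
  \<comment> \<open>Beyond \<open>k\<close> all of \<open>\<sigma>\<close> vanishes, and at
    \<open>k\<close> it is constantly \<open>x k\<close>. Against \<open>q\<close>, the point
    \<open>v\<close> therefore loses at most 1 in coordinate \<open>k\<close> and nothing
    elsewhere.\<close>
  define v where "v = restrict (\<lambda>i. if i < k then q i else if i = k then x k - 1 else 0) {..<n}"
  have v_grid: "v \<in> grid n m"
    using q xk kn sub x by (fastforce simp: grid_iff v_def)
  have "below \<sigma> v"
    unfolding below_def
  proof (intro conjI ballI v_grid)
    fix y assume y: "y \<in> \<sigma>"
    show "level n m v < level n m y"
      using top[OF y] kn sub y by (subst level_less_top[OF v_grid, of y k]) (auto simp: v_def)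
    have "\<bar>v i - y i\<bar> \<le> \<bar>q i - y i\<bar> + (if i = k then 1 else 0)" if "i < n" for i
      using top[OF y] that by (auto simp: v_def last_nonzero_def)
    then have "manhattan n v y \<le> (\<Sum>i<n. \<bar>q i - y i\<bar> + (if i = k then 1 else 0))"
      unfolding manhattan_def by (intro sum_mono) simp
    also have "\<dots> = manhattan n q y + 1"
      using kn by (simp add: sum.distrib manhattan_def)
    finally show "manhattan n v y \<le> 2"
      using center[OF y] by simp
  qed
  then show False
    using \<sigma> by (auto simp: critical_def)
qed

text \<open>A center of \<open>\<tau>\<close> would be one of \<open>\<sigma>\<close>. Allowing
  every clique above \<open>\<sigma>\<close> yields at once that critical simplices have four
  vertices and that they are maximal.\<close>

lemma critical_clique:
  assumes \<sigma>: "\<sigma> \<in> critical" and \<tau>: "\<tau> \<in> cliques" "\<sigma> \<subseteq> \<tau>"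
  shows "card \<tau> = 4"
proof (rule ccontr)
  assume "card \<tau> \<noteq> 4"
  then obtain q where "q \<in> grid n m" "\<forall>a\<in>\<tau>. manhattan n q a \<le> 1"
    using clique_center[of \<tau> n m] \<tau>(1) by (auto simp: cliques_def)
  then show False
    using critical_no_center[OF \<sigma>, of q] \<tau>(2) by force
qed

lemma wedge_of_critical_cells:
  "geom_realization (grid n m) cliques homotopy_equivalent_space wedge_S3 (card critical)"
proof (rule wedge_of_critical)
  have cl: "\<sigma> \<in> cliques" if "\<sigma> \<in> critical" for \<sigma>
    using that by (simp add: critical_def horizontal_def)
  show "card \<sigma> = 4" if "\<sigma> \<in> critical" for \<sigma>
    using critical_clique[OF that cl[OF that]] by simp
  show "\<tau> = \<sigma>" if "\<sigma> \<in> critical" "\<tau> \<in> cliques" "\<sigma> \<subseteq> \<tau>" for \<sigma> \<tau>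
  proof -
    have "card \<sigma> = 4" "card \<tau> = 4"
      using critical_clique[OF that(1)] that cl by auto
    then show ?thesis
      using card_subset_eq[of \<tau> \<sigma>] that(3) by (simp add: card_ge_0_finite)
  qed
qed

section \<open>Unit squares as critical simplices\<close>

definition pt :: "int \<Rightarrow> int \<Rightarrow> int \<Rightarrow> nat \<Rightarrow> int" where
  "pt x y z = restrict (\<lambda>i. if i = 0 then x else if i = 1 then y else if i = 2 then z else 0) {..<n}"

text \<open>The shift to \<open>z + 1\<close> lets all three parameters range over
  \<open>{0..<int m}\<close> while the height stays between 1 and m.\<close>

definition square :: "int \<times> int \<times> int \<Rightarrow> (nat \<Rightarrow> int) set" where
  "square = (\<lambda>(x, y, z). {pt x y (z + 1), pt (x + 1) y (z + 1), pt x (y + 1) (z + 1), pt (x + 1) (y + 1) (z + 1)})"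

lemma manhattan_pt:
  assumes "3 \<le> n"
  shows "\<bar>v 0 - x\<bar> + \<bar>v 1 - y\<bar> + \<bar>v 2 - z\<bar> \<le> manhattan n v (pt x y z)"
proof -
  have "(\<Sum>i\<in>{0,1,2}. \<bar>v i - pt x y z i\<bar>) \<le> manhattan n v (pt x y z)"
    unfolding manhattan_def using assms by (intro sum_mono2) auto
  then show ?thesis
    using assms by (simp add: pt_def)
qed

lemma manhattan_pt_pt:
  assumes "3 \<le> n"
  shows "manhattan n (pt x y z) (pt x' y' z') = \<bar>x - x'\<bar> + \<bar>y - y'\<bar> + \<bar>z - z'\<bar>"
proof -
  have "manhattan n (pt x y z) (pt x' y' z') = (\<Sum>i\<in>{0,1,2}. \<bar>pt x y z i - pt x' y' z' i\<bar>)"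
    unfolding manhattan_def using assms by (intro sum.mono_neutral_right) (auto simp: pt_def)
  then show ?thesis
    using assms by (simp add: pt_def)
qed

text \<open>The third coordinate is the last nonzero one, so a common lower neighbour spends at
  least 1 of its distance 2 there. At most 1 is left in the plane of the square, too little to reach
  all four corners.\<close>

lemma square_critical:
  assumes n: "3 \<le> n" and t: "t \<in> {0..<int m} \<times> {0..<int m} \<times> {0..<int m}"
  shows "square t \<in> critical"
proof -
  obtain x y z where xyz: "t = (x, y, z)"
    using prod_cases3 by blast
  have pts: "pt a b c \<in> grid n m" if "0 \<le> a" "a \<le> int m" "0 \<le> b" "b \<le> int m" "0 \<le> c" "c \<le> int m" for a b c
    using that by (auto simp: pt_def grid_iff)
  have top: "last_nonzero n (pt a b (z + 1)) 2" for a b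
    using n t xyz by (auto simp: last_nonzero_def pt_def)
  have z2: "pt a b (z + 1) 2 = z + 1" for a b
    using n by (simp add: pt_def)
  have "square t \<subseteq> grid n m"
    using t by (auto simp: square_def xyz pts)
  moreover have "\<forall>p\<in>square t. \<forall>q\<in>square t. manhattan n p q \<le> 2"
    by (auto simp: square_def xyz manhattan_pt_pt[OF n])
  moreover have "square t \<noteq> {}"
    by (simp add: square_def xyz)
  ultimately have cl: "square t \<in> cliques"
    by (simp add: cliques_def)
  have "level n m p = 2 * m + nat (z + 1)" if "p \<in> square t" for p
    using that level_top[OF top] z2 by (auto simp: square_def xyz)
  moreover have "0 < 2 * m + nat (z + 1)"
    using t xyz by simp
  ultimately have hor: "horizontal (square t)"
    using cl unfolding horizontal_def by blast
  have "\<not> below (square t) v" for v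
  proof
    assume v: "below (square t) v"
    then have vg: "v \<in> grid n m"
      by (simp add: below_def)
    have d: "manhattan n v p \<le> 2" and "level n m v < level n m p" if "p \<in> square t" for p
      using v that by (auto simp: below_def)
    then have "level n m v < level n m (pt x y (z + 1))"
      by (simp add: square_def xyz)
    then have "v 2 < z + 1"
      using level_less_top[OF vg _ top, of x y] cl z2 by (auto simp: cliques_def square_def xyz)
    have "\<bar>v 0 - a\<bar> + \<bar>v 1 - b\<bar> \<le> 1" if "pt a b (z + 1) \<in> square t" for a b
      using d[OF that] manhattan_pt[OF n, of v a b "z + 1"] \<open>v 2 < z + 1\<close> by linarith
    then have "\<bar>v 0 - x\<bar> + \<bar>v 1 - y\<bar> \<le> 1" "\<bar>v 0 - (x + 1)\<bar> + \<bar>v 1 - y\<bar> \<le> 1"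
      "\<bar>v 0 - x\<bar> + \<bar>v 1 - (y + 1)\<bar> \<le> 1" "\<bar>v 0 - (x + 1)\<bar> + \<bar>v 1 - (y + 1)\<bar> \<le> 1"
      by (auto simp: square_def xyz)
    \<comment> \<open>The integer points within 1 of two opposite corners are the other two corners,
      and these are at distance 2 from each other.\<close>
    then show False by presburger
  qed
  then show ?thesis
    using hor by (simp add: critical_def)
qed

lemma inj_square:
  assumes n: "3 \<le> n"
  shows "inj square"
proof
  fix s t assume eq: "square s = square t"
  obtain x y z x' y' z' where s: "s = (x, y, z)" and t: "t = (x', y', z')"
    using prod_cases3 by metis
  have pt: "pt a b c = pt a' b' c' \<longleftrightarrow> a = a' \<and> b = b' \<and> c = c'" for a b c a' b' c'
    using manhattan_pt_pt[OF n, of a b c a' b' c'] by auto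
  \<comment> \<open>Each base corner exceeds the other by 0 or 1 in the first two coordinates; in
    both directions this forces equality.\<close>
  have "pt x y (z + 1) \<in> square t" "pt x' y' (z' + 1) \<in> square s"
    using eq by (auto simp: square_def s t)
  then show "s = t"
    by (auto simp: square_def s t pt)
qed

lemma card_critical:
  assumes "3 \<le> n"
  shows "m ^ 3 \<le> card critical"
proof -
  let ?T = "{0..<int m} \<times> {0..<int m} \<times> {0..<int m}"
  have "finite critical"
    by (rule finite_subset[of _ "Pow (grid n m)"])
       (auto simp: critical_def horizontal_def cliques_def finite_grid)
  moreover have "square ` ?T \<subseteq> critical"
    using square_critical[OF assms] by blast
  ultimately have "card (square ` ?T) \<le> card critical"
    by (rule card_mono)
  moreover have "card (square ` ?T) = card ?T"
    using inj_square[OF assms] by (intro card_image) (auto intro: inj_on_subset)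
  ultimately show ?thesis
    by (simp add: power3_eq_cube)
qed

end

theorem theorem4p13:
  fixes n m :: nat
  assumes "n \<ge> 3" and "m \<ge> 3"
  shows "\<exists>\<nu>::nat. \<nu> \<ge> (m - 2) ^ 3 \<and>
    (geom_realization (grid n m) (VR (grid n m) (manhattan n) 2))
      homotopy_equivalent_space (wedge_S3 \<nu>)"
proof -
  interpret grid_levels n m .
  have "(m - 2) ^ 3 \<le> m ^ 3"
    by (intro power_mono) auto
  also have "\<dots> \<le> card critical"
    using assms(1) by (rule card_critical)
  finally show ?thesis
    using wedge_of_critical_cells cliques_eq_VR by auto
qed

end
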